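(* Suppose $(\mu_i)_{i=1}^\infty$ is a sequence of compactly supported Borel probability measures in a complete metric space $(X,d)$, let $\mu\in\mathscr P(X)$ and let $1\le p<\infty$. Then $W_\infty(\mu_i,\mu)\to0$ as $i\to\infty$ if and only if the following three conditions hold. (1) $W_p(\mu_i,\mu)\to0$ as $i\to\infty$. (2) $d_H(\operatorname{supp}\mu_i,\operatorname{supp}\mu)\to0$ as $i\to\infty$. (3) If there exist sequences of positive measures $(\mu_i^1)_{i=1}^\infty$ and $(\mu_i^2)_{i=1}^\infty$ such that $\mu_i=\mu_i^1+\mu_i^2$ for all $i$, $\mu_i^1\to\mu^1$ and $\mu_i^2\to\mu^2$ in the $W_p$ sense for some measures $\mu^1$ and $\mu^2$, and if $\inf_{i\in\mathbb N}\operatorname{dist}(\operatorname{supp}\mu_i^1,\operatorname{supp}\mu_i^2)>0$, then there exists $i_0\in\mathbb N$ such that $\mu_i^1(X)=\mu^1(X)$ for all $i\ge i_0$.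
   Context: $\mathscr P(X)$ is the set of Borel probability measures on $X$; $\operatorname{supp}\mu$ is the support of $\mu$, i.e. the smallest closed set of full $\mu$-measure. $\Pi(\mu,\nu)$ is the set of Borel probability measures on $X\times X$ with marginals $\mu$ and $\nu$. The transportation distances are $$W_p(\mu,\nu)=\inf_{\lambda\in\Pi(\mu,\nu)}\Big(\int d^p(x,y)\,\mathrm{d}\lambda(x,y)\Big)^{1/p},\qquad W_\infty(\mu,\nu)=\inf_{\lambda\in\Pi(\mu,\nu)}\lambda\text{-}\operatorname{ess\,sup}_{(x,y)\in X^2}d(x,y).$$ The Hausdorff distance between closed sets is $d_H(A,B)=\max\big(\sup_{x\in A}\operatorname{dist}(x,B),\sup_{y\in B}\operatorname{dist}(y,A)\big)$, and the distance between sets is $\operatorname{dist}(A,B)=\inf_{a\in A,b\in B}d(a,b)$, with the convention $\operatorname{dist}(A,B)=\infty$ if one of them is empty. For finite positive Borel measures $\alpha_i,\alpha$ (possibly with different total masses), "$\alpha_i\to\alpha$ in the $W_p$ sense" means that $\int\varphi\,\mathrm{d}\alpha_i\to\int\varphi\,\mathrm{d}\alpha$ for every bounded continuous $\varphi\colon X\to\mathbb R$ and, for some $x_0\in X$, $\int d(x,x_0)^p\,\mathrm{d}\alpha_i(x)\to\int d(x,x_0)^p\,\mathrm{d}\alpha(x)<\infty$. *)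

theory Defs
  imports "HOL-Probability.Probability_Measure" "HOL-Probability.Essential_Supremum"
begin

text \<open>
  The space $X$ is a type of class \<^class>\<open>metric_space\<close>, not assumed separable. On $X \times X$
  we use the Borel sets of the product topology, which may form a strictly larger sigma-algebra
  than the product of the Borel sigma-algebras. Distances between measures and between sets take
  values in \<^typ>\<open>ennreal\<close>, since they may be infinite.
\<close>

definition finite_borel_measure :: "'a::topological_space measure \<Rightarrow> bool" where
  "finite_borel_measure M \<longleftrightarrow> sets M = sets borel \<and> finite_measure M"

definition borel_prob :: "'a::topological_space measure \<Rightarrow> bool" where
  "borel_prob M \<longleftrightarrow> sets M = sets borel \<and> prob_space M"

text \<open>
  Without separability a smallest closed set of full measure need not exist. The intersection of
  all closed sets of full measure is always defined, and is the smallest one whenever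
  there is one.
\<close>

definition msupport :: "'a::topological_space measure \<Rightarrow> 'a set" where
  "msupport M = \<Inter>{C. closed C \<and> emeasure M (- C) = 0}"

lemma msupport_eq_smallest:
  assumes "closed S" "emeasure M (- S) = 0"
    and "\<And>C. closed C \<Longrightarrow> emeasure M (- C) = 0 \<Longrightarrow> S \<subseteq> C"
  shows "msupport M = S"
  using assms unfolding msupport_def by blast

text \<open>
  The second conjunct says that the smallest closed set of full measure exists; without it, a
  diffuse measure on a very large space could have empty, hence compact, \<^const>\<open>msupport\<close>.
\<close>

definition compactly_supported :: "'a::topological_space measure \<Rightarrow> bool" where
  "compactly_supported M \<longleftrightarrow> compact (msupport M) \<and> emeasure M (- msupport M) = 0"

definition couplings ::
  "'a::topological_space measure \<Rightarrow> 'a measure \<Rightarrow> ('a \<times> 'a) measure set" where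
  "couplings M N = {L. borel_prob L \<and> distr L borel fst = M \<and> distr L borel snd = N}"

text \<open>Only used for exponents $a > 0$, where $\infty^a = \infty$.\<close>

definition ennreal_powr :: "ennreal \<Rightarrow> real \<Rightarrow> ennreal" where
  "ennreal_powr x a = (if x = \<infinity> then \<infinity> else ennreal (enn2real x powr a))"

definition W :: "real \<Rightarrow> 'a::metric_space measure \<Rightarrow> 'a measure \<Rightarrow> ennreal" where
  "W p M N =
    (INF L\<in>couplings M N. ennreal_powr (\<integral>\<^sup>+ (x, y). ennreal (dist x y powr p) \<partial>L) (1 / p))"

definition W_inf :: "'a::metric_space measure \<Rightarrow> 'a measure \<Rightarrow> ennreal" where
  "W_inf M N = (INF L\<in>couplings M N. esssup L (\<lambda>(x, y). ennreal (dist x y)))"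

text \<open>Unlike \<^const>\<open>setdist\<close>, this distance is $\infty$ if one of the sets is empty.\<close>

definition set_dist :: "'a::metric_space set \<Rightarrow> 'a set \<Rightarrow> ennreal" where
  "set_dist A B = (INF a\<in>A. INF b\<in>B. ennreal (dist a b))"

definition hausdorff_dist :: "'a::metric_space set \<Rightarrow> 'a set \<Rightarrow> ennreal" where
  "hausdorff_dist A B = max (SUP x\<in>A. set_dist {x} B) (SUP y\<in>B. set_dist {y} A)"

definition W_conv :: "real \<Rightarrow> (nat \<Rightarrow> 'a::metric_space measure) \<Rightarrow> 'a measure \<Rightarrow> bool" where
  "W_conv p \<alpha> \<beta> \<longleftrightarrow>
    (\<forall>\<phi> :: 'a \<Rightarrow> real. continuous_on UNIV \<phi> \<and> bounded (range \<phi>) \<longrightarrow>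
      (\<lambda>i. \<integral>x. \<phi> x \<partial>\<alpha> i) \<longlonglongrightarrow> (\<integral>x. \<phi> x \<partial>\<beta>)) \<and>
    (\<exists>x0.
      (\<lambda>i. \<integral>\<^sup>+ x. ennreal (dist x x0 powr p) \<partial>\<alpha> i)
        \<longlonglongrightarrow> (\<integral>\<^sup>+ x. ennreal (dist x x0 powr p) \<partial>\<beta>) \<and>
      (\<integral>\<^sup>+ x. ennreal (dist x x0 powr p) \<partial>\<beta>) < \<infinity>)"

end

theory Submission
  imports Defs
begin

text \<open>
  Write \<open>K\<close> for the support of \<open>\<mu>\<close>. Either side of the equivalence forces \<open>K\<close> to be compact and of
  full measure: the measures \<open>\<mu>s i\<close> live on compact sets, small transport cost confines \<open>\<mu>\<close> to the
  separable closure of their union (\<open>full_msupport_of_nearly_diagonal\<close>), and the Hausdorff convergence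
  makes \<open>K\<close> totally bounded (\<open>compact_hausdorff_limit\<close>). From then on all arguments are about
  finite partitions of a neighbourhood of \<open>K\<close>.

  Suppose that \<^const>\<open>W_inf\<close> tends to zero. Couplings that move every point by a small distance bound
  the transport cost and the Hausdorff distance. If \<open>\<mu>s i\<close> splits into two parts with supports a fixed
  distance apart, then such a coupling keeps the parts apart, and the mass of the first part
  is the \<open>\<mu>\<close>-mass of a union of cells of one fixed finite partition. So it takes finitely many values
  (\<open>separated_part_mass_finitely_many_values\<close>), and since it converges it is eventually constant.

  Conversely, fix a scale. At this scale \<open>K\<close> falls into finitely many clusters, which are the components
  of a graph on a finite net; by the splitting condition \<open>\<mu>s i\<close> and \<open>\<mu>\<close> eventually agree on
  each of them (\<open>cluster_mass_eventually_eq\<close>). The optimal cost being small, there is a coupling that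
  moves all but a tiny amount of mass by a small distance only. The misplaced mass is
  small compared with the mass of every cell, and within a cluster it can be redistributed by a
  small flow along the edges of the graph (\<open>bounded_flow_exists\<close>). Instead of moving the misplaced
  particles across the whole cluster, one lets every particle move along at most one edge; this works because
  each cell has enough mass to feed the flow. The resulting transport plan between cells is
  realised by a coupling (\<open>recoupling\<close>) with small maximal displacement (\<open>W_inf_eventually_le\<close>).
\<close>

section \<open>Supports\<close>

lemma ennreal_tendsto_0_iff:
  fixes f :: "'b \<Rightarrow> ennreal"
  shows "(f \<longlongrightarrow> 0) F \<longleftrightarrow> (\<forall>e>0. eventually (\<lambda>i. f i < ennreal e) F)"
proof
  assume "(f \<longlongrightarrow> 0) F"
  then show "\<forall>e>0. eventually (\<lambda>i. f i < ennreal e) F"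
    by (auto intro: order_tendstoD(2))
next
  assume *: "\<forall>e>0. eventually (\<lambda>i. f i < ennreal e) F"
  show "(f \<longlongrightarrow> 0) F"
  proof (rule order_tendstoI)
    fix a :: ennreal assume "0 < a"
    then obtain b where b: "0 < b" "b < a" using dense by blast
    then have "b < top" by (meson less_le_trans top_greatest)
    then obtain r where r: "b = ennreal r" "0 \<le> r" by (cases b) auto
    with b have "0 < r" by simp
    with * have "eventually (\<lambda>i. f i < ennreal r) F" by blast
    then show "eventually (\<lambda>i. f i < a) F"
      by eventually_elim (use b r in \<open>auto intro: less_trans\<close>)
  qed simp
qed

lemma closed_msupport: "closed (msupport M)"
  unfolding msupport_def by auto

lemma msupport_subset: "closed C \<Longrightarrow> emeasure M (- C) = 0 \<Longrightarrow> msupport M \<subseteq> C"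
  unfolding msupport_def by blast

lemma emeasure_pos_of_msupport:
  assumes "x \<in> msupport M" "open U" "x \<in> U"
  shows "emeasure M U > 0"
proof (rule ccontr)
  assume "\<not> emeasure M U > 0"
  then have "msupport M \<subseteq> - U"
    using assms(2) by (intro msupport_subset) (auto simp: closed_def)
  with assms show False by blast
qed

text \<open>
  The complement of the support is a union of null open sets, but possibly an uncountable one. On a
  separable set, balls of radius \<open>1 / (n + 1)\<close> about a countable dense set form a countable family that
  refines every open cover, so countably many null balls suffice.
\<close>

lemma emeasure_compl_msupport:
  fixes M :: "'a::metric_space measure"
  assumes M: "sets M = sets borel" and S: "closed S" "emeasure M (- S) = 0"
    and D: "countable D" "S \<subseteq> closure D"
  shows "emeasure M (- msupport M) = 0"
proof -
  define B where "B = {B \<in> (\<lambda>(c, n). ball c (1 / real (Suc n))) ` (D \<times> UNIV). emeasure M B = 0}"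
  have B: "countable B" unfolding B_def using D(1) by (auto intro!: countable_Collect)
  have "(\<Union>B) \<in> null_sets M"
  proof -
    have "B0 \<in> null_sets M" if "B0 \<in> B" for B0
      using that by (auto simp: B_def M null_sets_def)
    then show ?thesis using null_sets_UN'[OF B, of "\<lambda>x. x" M] by simp
  qed
  moreover have "- S \<in> null_sets M" using S by (auto simp: null_sets_def M)
  moreover have "- msupport M \<subseteq> - S \<union> \<Union>B"
  proof
    fix x assume "x \<in> - msupport M"
    then obtain C where C: "closed C" "emeasure M (- C) = 0" "x \<notin> C"
      unfolding msupport_def by blast
    have "open (- C)" "x \<in> - C" using C by (auto simp: closed_def)
    then obtain r where r: "r > 0" "ball x r \<subseteq> - C" by (meson openE)
    show "x \<in> - S \<union> \<Union>B"
    proof (cases "x \<in> S")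
      case True
      obtain n where n: "1 / real (Suc n) < r / 2"
        using nat_approx_posE[of "r/2"] r(1) by auto
      obtain c where c: "c \<in> D" "dist c x < 1 / real (Suc n)"
        using True D(2) closure_approachable[of x D] by (meson divide_pos_pos of_nat_0_less_iff subsetD zero_less_Suc zero_less_one)
      have "ball c (1 / real (Suc n)) \<subseteq> ball x r"
      proof
        fix z assume "z \<in> ball c (1 / real (Suc n))"
        then show "z \<in> ball x r"
          using c n dist_triangle[of x z c] by (auto simp: dist_commute)
      qed
      then have "emeasure M (ball c (1 / real (Suc n))) \<le> emeasure M (- C)"
        using r C(1) by (intro emeasure_mono) (auto simp: M)
      then have "ball c (1 / real (Suc n)) \<in> B"
        unfolding B_def using c C(2) by auto
      moreover have "x \<in> ball c (1 / real (Suc n))" using c by simp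
      ultimately show ?thesis by blast
    qed auto
  qed
  moreover have "- msupport M \<in> sets M" using closed_msupport[of M] by (simp add: M)
  ultimately have "- msupport M \<in> null_sets M"
    by (meson null_sets.Un null_sets_subset)
  then show ?thesis by auto
qed

lemma compact_countable_dense:
  fixes K :: "'a::metric_space set"
  assumes "compact K"
  obtains D where "countable D" "K \<subseteq> closure D"
proof -
  have "\<exists>k. finite k \<and> K \<subseteq> (\<Union>x\<in>k. ball x (1 / real (Suc n)))" for n
    using assms[unfolded compact_eq_totally_bounded] by (auto simp del: of_nat_Suc)
  then obtain k where k: "\<And>n. finite (k n)" "\<And>n. K \<subseteq> (\<Union>x\<in>k n. ball x (1 / real (Suc n)))"
    by metis
  show thesis
  proof (rule that[of "\<Union>n. k n"])
    show "countable (\<Union>n. k n)" using k(1) by (auto intro: countable_finite)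
    show "K \<subseteq> closure (\<Union>n. k n)"
    proof
      fix x assume x: "x \<in> K"
      show "x \<in> closure (\<Union>n. k n)"
        unfolding closure_approachable
      proof safe
        fix e :: real assume "e > 0"
        then obtain n where n: "1 / real (Suc n) < e" using nat_approx_posE by blast
        obtain c where "c \<in> k n" "dist c x < 1 / real (Suc n)" using k(2)[of n] x by auto
        with n show "\<exists>y\<in>\<Union>n. k n. dist y x < e" by force
      qed
    qed
  qed
qed

section \<open>Couplings and transportation distances\<close>

lemma couplingsD:
  assumes "L \<in> couplings M N"
  shows "sets L = sets borel" "space L = UNIV" "prob_space L"
    "distr L borel fst = M" "distr L borel snd = N"
  using assms sets_eq_imp_space_eq[of L borel] unfolding couplings_def borel_prob_def by auto

lemma coupling_measurable:
  assumes "L \<in> couplings M N"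
  shows "f \<in> measurable L A \<longleftrightarrow> f \<in> measurable borel A"
  using measurable_cong_sets[OF couplingsD(1)[OF assms] refl] by blast

lemma coupling_fst_snd_measurable:
  assumes "L \<in> couplings M N"
  shows "fst \<in> measurable L borel" "snd \<in> measurable L borel"
  unfolding coupling_measurable[OF assms]
  by (auto intro!: borel_measurable_continuous_onI continuous_intros)

lemma borel_measurable_dist_fst_snd:
  "(\<lambda>z::'a::metric_space \<times> 'a. dist (fst z) (snd z)) \<in> borel_measurable borel"
  by (auto intro!: borel_measurable_continuous_onI continuous_intros)

lemma coupling_prob_fst:
  assumes "L \<in> couplings M N" "A \<in> sets borel"
  shows "measure L {z. fst z \<in> A} = measure M A"
  using couplingsD[OF assms(1)] coupling_fst_snd_measurable[OF assms(1)] assms(2)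
  by (auto simp: measure_distr vimage_def)

lemma coupling_prob_snd:
  assumes "L \<in> couplings M N" "A \<in> sets borel"
  shows "measure L {z. snd z \<in> A} = measure N A"
  using couplingsD[OF assms(1)] coupling_fst_snd_measurable[OF assms(1)] assms(2)
  by (auto simp: measure_distr vimage_def)

lemma coupling_AE_fst:
  assumes L: "L \<in> couplings M N" and A: "A \<in> sets borel" "emeasure M (- A) = 0"
  shows "AE z in L. fst z \<in> A"
proof -
  have "AE x in distr L borel fst. x \<in> A"
    using A couplingsD[OF L] by (intro AE_I[of _ _ "- A"]) auto
  then show ?thesis by (rule AE_distrD[OF coupling_fst_snd_measurable(1)[OF L]])
qed

lemma coupling_AE_snd:
  assumes L: "L \<in> couplings M N" and A: "A \<in> sets borel" "emeasure N (- A) = 0"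
  shows "AE z in L. snd z \<in> A"
proof -
  have "AE x in distr L borel snd. x \<in> A"
    using A couplingsD[OF L] by (intro AE_I[of _ _ "- A"]) auto
  then show ?thesis by (rule AE_distrD[OF coupling_fst_snd_measurable(2)[OF L]])
qed

lemma coupling_exceed_sets:
  fixes M :: "'a::metric_space measure"
  assumes "L \<in> couplings M N"
  shows "{z. dist (fst z) (snd z) > d} \<in> sets L"
proof -
  have "(\<lambda>z::'a \<times> 'a. dist (fst z) (snd z)) \<in> borel_measurable borel"
    by (rule borel_measurable_dist_fst_snd)
  then show ?thesis unfolding couplingsD(1)[OF assms]
    by (simp add: borel_measurable_iff_greater)
qed

definition nearly_diagonal :: "'a::metric_space measure \<Rightarrow> 'a measure \<Rightarrow> real \<Rightarrow> real \<Rightarrow> bool" where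
  "nearly_diagonal M N d h \<longleftrightarrow>
    (\<exists>L\<in>couplings M N. measure L {z. dist (fst z) (snd z) > d} < h)"

text \<open>
  By Markov's inequality a coupling of cost \<open>\<integral> dist\<^sup>p < d\<^sup>p h\<close> gives mass less than \<open>h\<close> to the pairs
  at distance more than \<open>d\<close>. As a hypothesis, convergence in \<^const>\<open>W\<close> is used only in
  this form.
\<close>

lemma nearly_diagonal_of_W_small:
  fixes M N :: "'a::metric_space measure"
  assumes p: "1 \<le> p" and d: "0 < d" and h: "0 < h"
    and W: "W p M N < ennreal ((d powr p * h) powr (1 / p))"
  shows "nearly_diagonal M N d h"
proof -
  obtain L where L: "L \<in> couplings M N"
    and lt: "ennreal_powr (\<integral>\<^sup>+ (x, y). ennreal (dist x y powr p) \<partial>L) (1 / p) <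
      ennreal ((d powr p * h) powr (1 / p))"
    using W unfolding W_def by (auto simp: INF_less_iff)
  define I where "I = (\<integral>\<^sup>+ z. ennreal (dist (fst z) (snd z) powr p) \<partial>L)"
  have I: "(\<integral>\<^sup>+ (x, y). ennreal (dist x y powr p) \<partial>L) = I"
    unfolding I_def by (intro nn_integral_cong) (auto split: prod.split)
  have fin: "I \<noteq> top" using lt unfolding I ennreal_powr_def by auto
  then have "enn2real I powr (1 / p) < (d powr p * h) powr (1 / p)"
    using lt unfolding I ennreal_powr_def by (auto simp: ennreal_less_iff)
  then have less: "enn2real I < d powr p * h"
    using powr_mono2[of "1 / p" "d powr p * h" "enn2real I"] p d h by (auto simp: not_le[symmetric])
  have [measurable]: "(\<lambda>z. dist (fst z) (snd z)) \<in> borel_measurable L"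
    unfolding coupling_measurable[OF L] by (rule borel_measurable_dist_fst_snd)
  interpret prob_space L by (rule couplingsD(3)[OF L])
  let ?E = "{z. dist (fst z) (snd z) > d}"
  have E: "?E \<in> sets L" by (rule coupling_exceed_sets[OF L])
  have "ennreal (d powr p) * emeasure L ?E = (\<integral>\<^sup>+ z. ennreal (d powr p) * indicator ?E z \<partial>L)"
    using E by (simp add: nn_integral_cmult)
  also have "\<dots> \<le> I" unfolding I_def
    using p d by (intro nn_integral_mono) (auto simp: indicator_def intro!: ennreal_leI powr_mono2)
  finally have "ennreal (d powr p * measure L ?E) \<le> ennreal (enn2real I)"
    using fin by (simp add: emeasure_eq_measure ennreal_mult less_top)
  then have "d powr p * measure L ?E \<le> enn2real I"
    by (subst (asm) ennreal_le_iff) auto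
  with less have "d powr p * measure L ?E < d powr p * h" by linarith
  then have "measure L ?E < h" using d by simp
  then show ?thesis using L unfolding nearly_diagonal_def by blast
qed

lemma eventually_nearly_diagonal:
  assumes "1 \<le> p" "((\<lambda>i. W p (\<mu>s i) \<mu>) \<longlongrightarrow> 0) F" "0 < d" "0 < h"
  shows "eventually (\<lambda>i. nearly_diagonal (\<mu>s i) \<mu> d h) F"
proof -
  have "0 < (d powr p * h) powr (1 / p)" using assms by simp
  then have "eventually (\<lambda>i. W p (\<mu>s i) \<mu> < ennreal ((d powr p * h) powr (1 / p))) F"
    using assms(2) unfolding ennreal_tendsto_0_iff by blast
  then show ?thesis
    by eventually_elim (use assms nearly_diagonal_of_W_small in blast)
qed

lemma W_inf_less_imp_coupling:
  assumes "W_inf M N < ennreal e"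
  obtains L where "L \<in> couplings M N" "AE z in L. dist (fst z) (snd z) < e"
proof -
  obtain L where L: "L \<in> couplings M N" and lt: "esssup L (\<lambda>(x, y). ennreal (dist x y)) < ennreal e"
    using assms unfolding W_inf_def by (auto simp: INF_less_iff)
  have "AE z in L. (\<lambda>(x, y). ennreal (dist x y)) z \<le> esssup L (\<lambda>(x, y). ennreal (dist x y))"
    by (rule esssup_AE)
  then have "AE z in L. dist (fst z) (snd z) < e"
  proof eventually_elim
    case (elim z)
    then have "ennreal (dist (fst z) (snd z)) < ennreal e"
      using lt by (auto simp: case_prod_beta intro: le_less_trans)
    then show ?case by (simp add: ennreal_less_iff)
  qed
  with L that show thesis by blast
qed

lemma W_inf_le_of_coupling:
  assumes L: "L \<in> couplings M N" and e: "AE z in L. dist (fst z) (snd z) \<le> e"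
  shows "W_inf M N \<le> ennreal e"
proof -
  have "esssup L (\<lambda>(x, y). ennreal (dist x y)) \<le> ennreal e"
  proof (rule esssup_I)
    show "(\<lambda>(x, y). ennreal (dist x y)) \<in> borel_measurable L"
      unfolding coupling_measurable[OF L] case_prod_beta
      using borel_measurable_dist_fst_snd by measurable
    show "AE z in L. (\<lambda>(x, y). ennreal (dist x y)) z \<le> ennreal e"
      using e by eventually_elim (auto intro: ennreal_leI)
  qed
  then show ?thesis unfolding W_inf_def using L by (meson INF_lower2)
qed

lemma W_le_of_coupling:
  assumes p: "1 \<le> p" and L: "L \<in> couplings M N" and e: "AE z in L. dist (fst z) (snd z) \<le> e" "0 \<le> e"
  shows "W p M N \<le> ennreal e"
proof -
  interpret prob_space L by (rule couplingsD(3)[OF L])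
  let ?I = "\<integral>\<^sup>+ (x, y). ennreal (dist x y powr p) \<partial>L"
  have "?I \<le> (\<integral>\<^sup>+ z. ennreal (e powr p) \<partial>L)"
    using e(1) p by (intro nn_integral_mono_AE, elim eventually_mono)
      (auto intro!: ennreal_leI powr_mono2)
  also have "\<dots> = ennreal (e powr p)" by (simp add: emeasure_space_1)
  finally have le: "?I \<le> ennreal (e powr p)" .
  then have "?I \<noteq> top" by (metis ennreal_less_top neq_top_trans less_top)
  moreover have "enn2real ?I powr (1 / p) \<le> (e powr p) powr (1 / p)"
    using le p by (intro powr_mono2) (auto simp: enn2real_leI)
  moreover have "(e powr p) powr (1 / p) = e" using p e by (simp add: powr_powr)
  ultimately have "ennreal_powr ?I (1 / p) \<le> ennreal e"
    unfolding ennreal_powr_def by (auto intro: ennreal_leI)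
  then show ?thesis unfolding W_def using L by (meson INF_lower2)
qed

section \<open>Hausdorff distance and the support of the limit\<close>

lemma hausdorff_dist_lessD:
  assumes "hausdorff_dist A B < ennreal e"
  shows "x \<in> A \<Longrightarrow> \<exists>y\<in>B. dist x y < e" "y \<in> B \<Longrightarrow> \<exists>x\<in>A. dist x y < e"
proof -
  assume "x \<in> A"
  then have "set_dist {x} B \<le> hausdorff_dist A B"
    unfolding hausdorff_dist_def by (meson SUP_upper max.coboundedI1)
  with assms show "\<exists>y\<in>B. dist x y < e"
    by (auto simp: set_dist_def INF_less_iff ennreal_less_iff dest!: le_less_trans)
next
  assume "y \<in> B"
  then have "set_dist {y} A \<le> hausdorff_dist A B"
    unfolding hausdorff_dist_def by (meson SUP_upper max.coboundedI2)
  with assms show "\<exists>x\<in>A. dist x y < e"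
    by (auto simp: set_dist_def INF_less_iff ennreal_less_iff dist_commute dest!: le_less_trans)
qed

lemma hausdorff_dist_leI:
  assumes "\<And>x. x \<in> A \<Longrightarrow> \<exists>y\<in>B. dist x y \<le> e" "\<And>y. y \<in> B \<Longrightarrow> \<exists>x\<in>A. dist x y \<le> e"
  shows "hausdorff_dist A B \<le> ennreal e"
proof -
  have "set_dist {x} B \<le> ennreal e" if "x \<in> A" for x
    using assms(1)[OF that] unfolding set_dist_def
    by (auto intro: INF_lower2 ennreal_leI)
  moreover have "set_dist {y} A \<le> ennreal e" if "y \<in> B" for y
    using assms(2)[OF that] unfolding set_dist_def
    by (auto intro: INF_lower2 ennreal_leI simp: dist_commute)
  ultimately show ?thesis
    unfolding hausdorff_dist_def by (auto intro!: SUP_least)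
qed

lemma borel_msupport: "msupport M \<in> sets borel"
  by (rule borel_closed[OF closed_msupport])

lemma borel_probD:
  assumes "borel_prob M"
  shows "sets M = sets borel" "space M = UNIV" "prob_space M"
  using assms sets_eq_imp_space_eq[of M borel] unfolding borel_prob_def by auto

lemma msupport_nonempty:
  assumes "borel_prob M" "emeasure M (- msupport M) = 0"
  shows "msupport M \<noteq> {}"
  using assms(2) prob_space.emeasure_space_1[OF borel_probD(3)[OF assms(1)]] borel_probD(2)[OF assms(1)]
  by auto

text \<open>
  All the compact supports lie in one separable closed set \<open>S\<close>. A point outside the
  \<open>d\<close>-neighbourhood of \<open>S\<close> can only be reached from \<open>S\<close> by moving more than \<open>d\<close>, which happens with
  arbitrarily small mass. Hence the limit lives on \<open>S\<close>, and a measure on a separable set has a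
  support of full measure.
\<close>

lemma full_msupport_of_nearly_diagonal:
  fixes \<mu> :: "'a::metric_space measure"
  assumes \<mu>s: "\<And>i. borel_prob (\<mu>s i)" "\<And>i. compactly_supported (\<mu>s i)" and \<mu>: "borel_prob \<mu>"
    and nd: "\<And>d h. 0 < d \<Longrightarrow> 0 < h \<Longrightarrow> \<exists>i::nat. nearly_diagonal (\<mu>s i) \<mu> d h"
  shows "emeasure \<mu> (- msupport \<mu>) = 0"
proof -
  define S where "S = closure (\<Union>i. msupport (\<mu>s i))"
  have comp: "compact (msupport (\<mu>s i))" "emeasure (\<mu>s i) (- msupport (\<mu>s i)) = 0" for i
    using \<mu>s(2) unfolding compactly_supported_def by auto
  have "\<exists>D. countable D \<and> msupport (\<mu>s i) \<subseteq> closure D" for i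
    using compact_countable_dense[OF comp(1)] by blast
  then obtain D where D: "\<And>i. countable (D i)" "\<And>i. msupport (\<mu>s i) \<subseteq> closure (D i)"
    by metis
  have S: "S \<subseteq> closure (\<Union>i. D i)"
    unfolding S_def
  proof (rule closure_minimal)
    show "(\<Union>i. msupport (\<mu>s i)) \<subseteq> closure (\<Union>i. D i)"
      using D(2) closure_mono[of "D _" "\<Union>i. D i"] by blast
  qed simp
  have S_ne: "S \<noteq> {}" using msupport_nonempty[OF \<mu>s(1) comp(2)] unfolding S_def by auto
  have sub: "msupport (\<mu>s i) \<subseteq> S" for i
    unfolding S_def by (rule order.trans[OF UN_upper[OF UNIV_I] closure_subset])
  interpret M: prob_space \<mu> by (rule borel_probD(3)[OF \<mu>])
  define U where "U = (\<lambda>n. {y. infdist y S > 1 / real (Suc n)})"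
  have openU: "open (U n)" for n
    unfolding U_def by (intro open_Collect_less continuous_intros)
  have "U n \<in> null_sets \<mu>" for n
  proof -
    have "measure \<mu> (U n) \<le> h" if h: "h > 0" for h
    proof -
      obtain i L where L: "L \<in> couplings (\<mu>s i) \<mu>"
        and small: "measure L {z. dist (fst z) (snd z) > 1 / real (Suc n)} < h"
        using nd[of "1 / real (Suc n)" h] h unfolding nearly_diagonal_def
        by (auto simp del: of_nat_Suc)
      interpret L: prob_space L by (rule couplingsD(3)[OF L])
      have "AE z in L. fst z \<in> msupport (\<mu>s i)"
        by (rule coupling_AE_fst[OF L borel_msupport comp(2)])
      then have "AE z in L. snd z \<in> U n \<longrightarrow> dist (fst z) (snd z) > 1 / real (Suc n)"
      proof eventually_elim
        case (elim z)
        then have "infdist (snd z) S \<le> dist (snd z) (fst z)"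
          using sub by (intro infdist_le) auto
        then show ?case unfolding U_def by (auto simp: dist_commute)
      qed
      then have "measure L {z. snd z \<in> U n} \<le> measure L {z. dist (fst z) (snd z) > 1 / real (Suc n)}"
        by (intro L.finite_measure_mono_AE coupling_exceed_sets[OF L]) auto
      then show ?thesis using small coupling_prob_snd[OF L, of "U n"] openU by auto
    qed
    then have "measure \<mu> (U n) = 0"
      by (meson field_le_epsilon measure_le_0_iff add_0 order.trans le_add_same_cancel1 dense_ge)
    then show ?thesis using openU by (auto simp: null_sets_def borel_probD[OF \<mu>] M.emeasure_eq_measure)
  qed
  then have null: "(\<Union>n. U n) \<in> null_sets \<mu>" by blast
  have "- S \<subseteq> (\<Union>n. U n)"
  proof
    fix y assume "y \<in> - S"
    then have "infdist y S > 0"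
      using in_closed_iff_infdist_zero[of S y] S_ne infdist_nonneg[of y S]
      by (auto simp: S_def less_le)
    then obtain n where "1 / real (Suc n) < infdist y S" using nat_approx_posE by blast
    then show "y \<in> (\<Union>n. U n)" unfolding U_def by auto
  qed
  then have "- S \<in> null_sets \<mu>"
    using null by (intro null_sets_subset[OF null]) (auto simp: borel_probD[OF \<mu>] S_def)
  then show ?thesis
    using S D(1) borel_probD[OF \<mu>]
    by (intro emeasure_compl_msupport[of \<mu> S "\<Union>i. D i"]) (auto simp: S_def)
qed

lemma compact_hausdorff_limit:
  fixes K :: "'a::complete_space set"
  assumes K: "closed K" and Ks: "\<And>i. compact (Ks i)"
    and close: "\<And>e. 0 < e \<Longrightarrow> \<exists>i. hausdorff_dist (Ks i) K < ennreal e"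
  shows "compact K"
  unfolding compact_eq_totally_bounded
proof safe
  show "complete K" using K by (simp add: complete_eq_closed)
  fix e :: real assume e: "e > 0"
  then obtain i where i: "hausdorff_dist (Ks i) K < ennreal (e / 2)" using close[of "e/2"] by auto
  obtain k where k: "finite k" "Ks i \<subseteq> (\<Union>x\<in>k. ball x (e / 2))"
    using Ks[of i] e unfolding compact_eq_totally_bounded by (meson half_gt_zero)
  have "K \<subseteq> (\<Union>x\<in>k. ball x e)"
  proof
    fix y assume "y \<in> K"
    then obtain x where x: "x \<in> Ks i" "dist x y < e / 2"
      using hausdorff_dist_lessD(2)[OF i] by blast
    then obtain c where "c \<in> k" "dist c x < e / 2" using k(2) by auto
    with x show "y \<in> (\<Union>x\<in>k. ball x e)" using dist_triangle_half_l[of c x e y]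
      by (auto simp: dist_commute intro!: bexI[of _ c] intro: dist_triangle_half_l)
  qed
  with k(1) show "\<exists>k. finite k \<and> K \<subseteq> (\<Union>x\<in>k. ball x e)" by blast
qed

section \<open>Nearest-point partitions\<close>

text \<open>
  The cells of the partition of the space according to the nearest of finitely many centres. Each cell
  must contain a ball about a point of \<open>K\<close>, so that it has positive mass when \<open>K\<close> is the support of a
  measure. This is arranged by taking a cover of \<open>K\<close> with the least possible number of balls: every
  ball then contains a point of \<open>K\<close> that no other ball contains, and all points close enough to it
  have the same nearest centre.
\<close>

lemma nearest_point_net:
  fixes K :: "'a::metric_space set"
  assumes K: "compact K" "K \<noteq> {}" and d: "0 < d"
  obtains n :: nat and y :: "nat \<Rightarrow> 'a" and q :: "'a \<Rightarrow> nat"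
  where "q \<in> borel \<rightarrow>\<^sub>M count_space UNIV" "\<And>x. q x < n"
    "\<And>x z. z \<in> K \<Longrightarrow> dist x z \<le> d \<Longrightarrow> dist x (y (q x)) < 2 * d"
    "\<And>l. l < n \<Longrightarrow> \<exists>x\<in>K. \<exists>r>0. ball x r \<subseteq> q -` {l}"
proof -
  define P where "P = (\<lambda>n. \<exists>y::nat \<Rightarrow> 'a. K \<subseteq> (\<Union>i<n. ball (y i) d))"
  obtain k where k: "finite k" "K \<subseteq> (\<Union>x\<in>k. ball x d)"
    using K d unfolding compact_eq_totally_bounded by blast
  obtain y0 :: "nat \<Rightarrow> 'a" and m where "k = y0 ` {i. i < m}"
    using finite_imp_nat_seg_image_inj_on[OF k(1)] by blast
  then have "P m" using k(2) unfolding P_def by (intro exI[of _ y0]) auto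
  define n where "n = (LEAST n. P n)"
  have "P n" and least: "\<And>m. m < n \<Longrightarrow> \<not> P m"
    unfolding n_def using \<open>P m\<close> by (auto intro: LeastI dest: not_less_Least)
  then obtain y where y: "K \<subseteq> (\<Union>i<n. ball (y i) d)" unfolding P_def by blast
  have n: "n > 0" using y K(2) by (cases n) auto
  \<comment> \<open>Ties between nearest centres are broken by the least index, which keeps \<open>q\<close> measurable.\<close>
  define N where "N = (\<lambda>x i. i < n \<and> (\<forall>j<n. dist x (y i) \<le> dist x (y j)))"
  define q where "q = (\<lambda>x. LEAST i. N x i)"
  have "\<exists>i. N x i" for x
  proof -
    obtain i where "i \<in> {..<n}" "\<forall>j\<in>{..<n}. dist x (y i) \<le> dist x (y j)"
      using ex_min_if_finite[of "(\<lambda>j. dist x (y j)) ` {..<n}"] n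
      by (fastforce simp: not_less)
    then show ?thesis unfolding N_def by blast
  qed
  then have q: "N x (q x)" for x unfolding q_def by (metis LeastI)
  show thesis
  proof (rule that[of q n y])
    have [measurable]: "(\<lambda>x. dist x c) \<in> borel_measurable borel" for c :: 'a
      by (intro borel_measurable_continuous_onI continuous_intros)
    show "q \<in> borel \<rightarrow>\<^sub>M count_space UNIV"
      unfolding q_def N_def by measurable
    show "q x < n" for x using q[of x] unfolding N_def by blast
    show "dist x (y (q x)) < 2 * d" if z: "z \<in> K" "dist x z \<le> d" for x z
    proof -
      obtain j where "j < n" "dist (y j) z < d" using y z(1) by auto
      moreover have "dist x (y (q x)) \<le> dist x (y j)" using q[of x] \<open>j < n\<close> unfolding N_def by blast
      ultimately show ?thesis using dist_triangle[of x "y j" z] z(2) by (auto simp: dist_commute)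
    qed
    show "\<exists>x\<in>K. \<exists>r>0. ball x r \<subseteq> q -` {l}" if l: "l < n" for l
    proof -
      have "\<exists>x\<in>K. \<forall>j<n. j \<noteq> l \<longrightarrow> d \<le> dist x (y j)"
      proof (rule ccontr)
        assume neg: "\<not> ?thesis"
        \<comment> \<open>The \<open>l\<close>-th ball would be superfluous, and the other centres renumbered would contradict minimality.\<close>
        define y' where "y' = (\<lambda>j. if j < l then y j else y (Suc j))"
        have "K \<subseteq> (\<Union>i<n - 1. ball (y' i) d)"
        proof
          fix x assume "x \<in> K"
          with neg obtain j where j: "j < n" "j \<noteq> l" "dist x (y j) < d" by (auto simp: not_le)
          show "x \<in> (\<Union>i<n - 1. ball (y' i) d)"
          proof (cases "j < l")
            case True
            then show ?thesis using j l by (auto simp: y'_def dist_commute intro!: bexI[of _ j])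
          next
            case False
            then have "Suc (j - 1) = j" using j by auto
            then show ?thesis using j l False
              by (auto simp: y'_def dist_commute intro!: bexI[of _ "j - 1"])
          qed
        qed
        then have "P (n - 1)" unfolding P_def by blast
        then show False using least[of "n - 1"] n by simp
      qed
      then obtain x where x: "x \<in> K" "\<And>j. j < n \<Longrightarrow> j \<noteq> l \<Longrightarrow> d \<le> dist x (y j)" by blast
      obtain j where "j < n" "dist x (y j) < d" using y x(1) by (auto simp: dist_commute)
      then have xl: "dist x (y l) < d" using x(2) by fastforce
      define r where "r = (d - dist x (y l)) / 2"
      have "q z = l" if "dist x z < r" for z
      proof (rule ccontr)
        assume "q z \<noteq> l"
        moreover have "q z < n" "dist z (y (q z)) \<le> dist z (y l)" using q[of z] l unfolding N_def by auto
        ultimately have "d \<le> dist x (y (q z))" using x(2) by blast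
        also have "\<dots> \<le> dist x z + dist z (y (q z))" by (rule dist_triangle)
        also have "\<dots> \<le> dist x z + dist z (y l)" using \<open>dist z (y (q z)) \<le> dist z (y l)\<close> by simp
        also have "\<dots> \<le> dist x z + (dist x z + dist x (y l))"
          using dist_triangle[of z "y l" x] by (simp add: dist_commute)
        also have "\<dots> < d" using that unfolding r_def by (simp add: field_simps)
        finally show False by simp
      qed
      moreover have "r > 0" using xl unfolding r_def by simp
      ultimately show ?thesis using x(1) by (intro bexI[of _ x] exI[of _ r]) auto
    qed
  qed
qed

section \<open>Balancing flows on finite graphs\<close>

text \<open>
  A path from \<open>a\<close> to \<open>b\<close>, read as an antisymmetric function on the edges, has net outflow one
  at \<open>a\<close>, minus one at \<open>b\<close> and zero elsewhere.
\<close>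

lemma unit_flow_of_path:
  fixes I :: "'i set"
  assumes I: "finite I" and R: "R \<subseteq> I \<times> I" "sym R" and ab: "(a, b) \<in> R\<^sup>*"
  shows "\<exists>g::'i \<Rightarrow> 'i \<Rightarrow> real. (\<forall>k l. g l k = - g k l) \<and> (\<forall>k l. g k l \<noteq> 0 \<longrightarrow> (k, l) \<in> R) \<and>
    (\<forall>k\<in>I. (\<Sum>l\<in>I. g k l) = of_bool (k = a) - of_bool (k = b))"
  using ab
proof (induction rule: rtrancl_induct)
  case base
  show ?case by (rule exI[of _ "\<lambda>_ _. 0"]) auto
next
  case (step b c)
  then obtain g :: "'i \<Rightarrow> 'i \<Rightarrow> real" where g: "\<And>k l. g l k = - g k l" "\<And>k l. g k l \<noteq> 0 \<Longrightarrow> (k, l) \<in> R"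
    "\<And>k. k \<in> I \<Longrightarrow> (\<Sum>l\<in>I. g k l) = of_bool (k = a) - of_bool (k = b)"
    by blast
  have bc: "b \<in> I" "c \<in> I" "(c, b) \<in> R" using step(2) R by (auto dest: symD)
  define g' :: "'i \<Rightarrow> 'i \<Rightarrow> real" where
    "g' k l = g k l + of_bool (k = b) * of_bool (l = c) - of_bool (k = c) * of_bool (l = b)" for k l
  have "(\<Sum>l\<in>I. g' k l) = of_bool (k = a) - of_bool (k = c)" if "k \<in> I" for k
  proof -
    have "(\<Sum>l\<in>I. g' k l) = (\<Sum>l\<in>I. g k l) + of_bool (k = b) * (\<Sum>l\<in>I. of_bool (l = c))
        - of_bool (k = c) * (\<Sum>l\<in>I. of_bool (l = b))"
      unfolding g'_def by (simp add: sum.distrib sum_subtractf sum_distrib_left)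
    also have "\<dots> = of_bool (k = a) - of_bool (k = c)"
      using g(3)[OF that] bc I by (simp add: of_bool_def sum.delta)
    finally show ?thesis .
  qed
  moreover have "g' l k = - g' k l" for k l unfolding g'_def using g(1)[of k l] by simp
  moreover have "g' k l \<noteq> 0 \<Longrightarrow> (k, l) \<in> R" for k l
    unfolding g'_def using g(2)[of k l] bc step(2) by (auto simp: of_bool_def split: if_splits)
  ultimately show ?case by blast
qed

text \<open>
  Sending the surplus \<open>w a\<close> of every vertex along a fixed path to a representative \<open>r a\<close> of its
  component balances every \<open>w\<close> whose sum over each component is zero, since then the surplus
  collected at the representative cancels. The flow is linear in \<open>w\<close>, so \<open>C\<close> depends only on the
  graph: small imbalances are repaired by small flows.
\<close>

lemma bounded_flow_exists:
  fixes I :: "'i set"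
  assumes I: "finite I" and R: "R \<subseteq> I \<times> I" "sym R"
  obtains C :: real where "0 \<le> C"
    "\<And>w. (\<And>a. a \<in> I \<Longrightarrow> (\<Sum>k\<in>{k\<in>I. (a, k) \<in> R\<^sup>*}. w k) = 0) \<Longrightarrow>
      \<exists>f::'i \<Rightarrow> 'i \<Rightarrow> real. (\<forall>k l. 0 \<le> f k l) \<and> (\<forall>k l. f k l > 0 \<longrightarrow> (k, l) \<in> R \<and> k \<noteq> l) \<and>
        (\<forall>k\<in>I. (\<Sum>l\<in>I. f k l) - (\<Sum>l\<in>I. f l k) = w k) \<and>
        (\<forall>k\<in>I. (\<Sum>l\<in>I. f k l) \<le> C * (\<Sum>a\<in>I. \<bar>w a\<bar>))"
proof -
  define r where "r = (\<lambda>a. SOME b. (a, b) \<in> R\<^sup>*)"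
  have r: "(a, r a) \<in> R\<^sup>*" for a unfolding r_def by (rule someI[of _ a]) simp
  have sym': "sym (R\<^sup>*)" by (rule sym_rtrancl[OF R(2)])
  have r_eq: "r a = r b \<longleftrightarrow> (a, b) \<in> R\<^sup>*" for a b
  proof
    assume "r a = r b"
    then show "(a, b) \<in> R\<^sup>*" using r[of a] r[of b] sym' by (metis rtrancl_trans symD)
  next
    assume "(a, b) \<in> R\<^sup>*"
    then have "(a, c) \<in> R\<^sup>* \<longleftrightarrow> (b, c) \<in> R\<^sup>*" for c using sym' by (metis rtrancl_trans symD)
    then show "r a = r b" unfolding r_def by simp
  qed
  have "\<forall>a. \<exists>g::'i \<Rightarrow> 'i \<Rightarrow> real. (\<forall>k l. g l k = - g k l) \<and> (\<forall>k l. g k l \<noteq> 0 \<longrightarrow> (k, l) \<in> R) \<and>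
    (\<forall>k\<in>I. (\<Sum>l\<in>I. g k l) = of_bool (k = a) - of_bool (k = r a))"
    using unit_flow_of_path[OF I R r] by blast
  then obtain g :: "'i \<Rightarrow> 'i \<Rightarrow> 'i \<Rightarrow> real" where g: "\<And>a k l. g a l k = - g a k l"
    "\<And>a k l. g a k l \<noteq> 0 \<Longrightarrow> (k, l) \<in> R"
    "\<And>a k. k \<in> I \<Longrightarrow> (\<Sum>l\<in>I. g a k l) = of_bool (k = a) - of_bool (k = r a)"
    by metis
  define C where "C = (\<Sum>a\<in>I. \<Sum>k\<in>I. \<Sum>l\<in>I. \<bar>g a k l\<bar>)"
  have C_ge: "(\<Sum>l\<in>I. \<bar>g a k l\<bar>) \<le> C" if "a \<in> I" "k \<in> I" for a k
  proof -
    have "(\<Sum>l\<in>I. \<bar>g a k l\<bar>) \<le> (\<Sum>k\<in>I. \<Sum>l\<in>I. \<bar>g a k l\<bar>)"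
      by (rule member_le_sum[of k I "\<lambda>k. \<Sum>l\<in>I. \<bar>g a k l\<bar>"]) (use that I in \<open>auto intro: sum_nonneg\<close>)
    also have "\<dots> \<le> C" unfolding C_def
      by (rule member_le_sum[of a I "\<lambda>a. \<Sum>k\<in>I. \<Sum>l\<in>I. \<bar>g a k l\<bar>"])
        (use that I in \<open>auto intro!: sum_nonneg\<close>)
    finally show ?thesis .
  qed
  show thesis
  proof (rule that[of C])
    show "0 \<le> C" unfolding C_def by (intro sum_nonneg) auto
    fix w :: "'i \<Rightarrow> real"
    assume w: "\<And>a. a \<in> I \<Longrightarrow> (\<Sum>k\<in>{k\<in>I. (a, k) \<in> R\<^sup>*}. w k) = 0"
    define h where "h = (\<lambda>k l. \<Sum>a\<in>I. w a * g a k l)"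
    \<comment> \<open>The positive part of an antisymmetric flow has the same net outflow.\<close>
    define f where "f = (\<lambda>k l. max 0 (h k l))"
    have h_anti: "h l k = - h k l" for k l
    proof -
      have "w a * g a l k = - (w a * g a k l)" for a
        using g(1)[where a=a and k=k and l=l] by simp
      then show ?thesis unfolding h_def by (simp only: sum_negf)
    qed
    have h_sum: "(\<Sum>l\<in>I. h k l) = w k" if k: "k \<in> I" for k
    proof -
      have "(\<Sum>l\<in>I. h k l) = (\<Sum>a\<in>I. w a * (\<Sum>l\<in>I. g a k l))"
        unfolding h_def by (subst sum.swap) (simp add: sum_distrib_left)
      also have "\<dots> = (\<Sum>a\<in>I. w a * of_bool (k = a)) - (\<Sum>a\<in>I. w a * of_bool (k = r a))"
        using g(3)[OF k] by (simp add: right_diff_distrib sum_subtractf)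
      also have "(\<Sum>a\<in>I. w a * of_bool (k = a)) = w k"
        using k I by (simp add: of_bool_def if_distrib sum.delta cong: if_cong)
      also have "(\<Sum>a\<in>I. w a * of_bool (k = r a)) = (\<Sum>a\<in>{a\<in>I. k = r a}. w a)"
        using I by (simp add: of_bool_def if_distrib sum.inter_filter cong: if_cong)
      also have "\<dots> = 0"
      proof (cases "\<exists>a\<in>I. k = r a")
        case True
        then obtain a where "a \<in> I" "k = r a" by blast
        then show ?thesis using w[of a] by (simp add: r_eq)
      next
        case False
        then have "{a\<in>I. k = r a} = {}" by blast
        then show ?thesis by (metis sum.empty)
      qed
      finally show ?thesis by simp
    qed
    have "f k l > 0 \<longrightarrow> (k, l) \<in> R \<and> k \<noteq> l" for k l
    proof
      assume "f k l > 0"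
      then have pos: "h k l > 0" unfolding f_def by auto
      then have "k \<noteq> l" using h_anti[of k k] by auto
      moreover have "\<exists>a. g a k l \<noteq> 0"
        by (rule ccontr) (use pos in \<open>simp add: h_def\<close>)
      ultimately show "(k, l) \<in> R \<and> k \<noteq> l" using g(2) by blast
    qed
    moreover have "(\<Sum>l\<in>I. f k l) - (\<Sum>l\<in>I. f l k) = w k" if "k \<in> I" for k
    proof -
      have "f k l - f l k = h k l" for l unfolding f_def using h_anti[of k l] by auto
      then show ?thesis using h_sum[OF that] by (simp add: sum_subtractf[symmetric])
    qed
    moreover have "(\<Sum>l\<in>I. f k l) \<le> C * (\<Sum>a\<in>I. \<bar>w a\<bar>)" if "k \<in> I" for k
    proof -
      have "(\<Sum>l\<in>I. f k l) \<le> (\<Sum>l\<in>I. \<Sum>a\<in>I. \<bar>w a\<bar> * \<bar>g a k l\<bar>)"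
      proof (rule sum_mono)
        fix l
        have "f k l \<le> \<bar>h k l\<bar>" unfolding f_def by auto
        also have "\<dots> \<le> (\<Sum>a\<in>I. \<bar>w a\<bar> * \<bar>g a k l\<bar>)"
          unfolding h_def using sum_abs[of "\<lambda>a. w a * g a k l" I] by (simp add: abs_mult)
        finally show "f k l \<le> (\<Sum>a\<in>I. \<bar>w a\<bar> * \<bar>g a k l\<bar>)" .
      qed
      also have "\<dots> = (\<Sum>a\<in>I. \<bar>w a\<bar> * (\<Sum>l\<in>I. \<bar>g a k l\<bar>))"
        by (subst sum.swap) (simp add: sum_distrib_left)
      also have "\<dots> \<le> (\<Sum>a\<in>I. \<bar>w a\<bar> * C)"
        using C_ge that by (intro sum_mono mult_left_mono) auto
      also have "\<dots> = C * (\<Sum>a\<in>I. \<bar>w a\<bar>)" by (simp add: sum_distrib_left mult.commute)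
      finally show ?thesis .
    qed
    moreover have "0 \<le> f k l" for k l unfolding f_def by simp
    ultimately show "\<exists>f::'i \<Rightarrow> 'i \<Rightarrow> real. (\<forall>k l. 0 \<le> f k l) \<and> (\<forall>k l. f k l > 0 \<longrightarrow> (k, l) \<in> R \<and> k \<noteq> l) \<and>
        (\<forall>k\<in>I. (\<Sum>l\<in>I. f k l) - (\<Sum>l\<in>I. f l k) = w k) \<and>
        (\<forall>k\<in>I. (\<Sum>l\<in>I. f k l) \<le> C * (\<Sum>a\<in>I. \<bar>w a\<bar>))"
      by (intro exI[of _ f]) blast
  qed
qed

section \<open>Couplings from finite transport plans\<close>

text \<open>
  On a separable set the Borel sets of the product are generated by countably many rectangles.
  This and the next lemma allow a measure on the product sigma-algebra to be pushed
  forward to a Borel measure on \<open>X \<times> X\<close>.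
\<close>

lemma open_covered_by_borel_rectangles:
  fixes U :: "('a::metric_space \<times> 'a) set"
  assumes U: "open U" and D: "countable D" "S \<subseteq> closure D"
  obtains V where "V \<in> sets (borel \<Otimes>\<^sub>M borel)" "V \<subseteq> U" "U \<inter> S \<times> S \<subseteq> V"
proof -
  define Q where "Q = (\<lambda>(a, b, n). ball a (1 / real (Suc n)) \<times> ball b (1 / real (Suc n)) :: ('a \<times> 'a) set)"
  define T where "T = {t \<in> D \<times> D \<times> (UNIV :: nat set). Q t \<subseteq> U}"
  have T: "countable T" unfolding T_def using D(1) by (intro countable_Collect countable_SIGMA) auto
  show thesis
  proof (rule that[of "\<Union>t\<in>T. Q t"])
    show "(\<Union>t\<in>T. Q t) \<in> sets (borel \<Otimes>\<^sub>M borel)"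
      using T by (intro sets.countable_UN') (auto simp: Q_def split: prod.split intro!: pair_measureI)
    show "(\<Union>t\<in>T. Q t) \<subseteq> U" unfolding T_def by auto
    show "U \<inter> S \<times> S \<subseteq> (\<Union>t\<in>T. Q t)"
    proof safe
      fix x y assume xy: "(x, y) \<in> U" "x \<in> S" "y \<in> S"
      obtain A B where AB: "open A" "open B" "x \<in> A" "y \<in> B" "A \<times> B \<subseteq> U"
        using open_prod_elim[OF U xy(1)] by (metis mem_Sigma_iff)
      obtain r1 where r1: "r1 > 0" "ball x r1 \<subseteq> A" using AB(1,3) openE by blast
      obtain r2 where r2: "r2 > 0" "ball y r2 \<subseteq> B" using AB(2,4) openE by blast
      obtain n where n: "1 / real (Suc n) < min r1 r2 / 2"
        using nat_approx_posE[of "min r1 r2 / 2"] r1 r2 by auto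
      have pos: "0 < 1 / real (Suc n)" by simp
      obtain a where a: "a \<in> D" "dist a x < 1 / real (Suc n)"
        using D(2) xy(2) pos unfolding closure_approachable[symmetric] by (meson closure_approachable subsetD)
      obtain b where b: "b \<in> D" "dist b y < 1 / real (Suc n)"
        using D(2) xy(3) pos unfolding closure_approachable[symmetric] by (meson closure_approachable subsetD)
      have "ball a (1 / real (Suc n)) \<subseteq> ball x r1"
      proof
        fix z assume "z \<in> ball a (1 / real (Suc n))"
        then show "z \<in> ball x r1" using dist_triangle[of x z a] a(2) n by (simp add: dist_commute)
      qed
      moreover have "ball b (1 / real (Suc n)) \<subseteq> ball y r2"
      proof
        fix z assume "z \<in> ball b (1 / real (Suc n))"
        then show "z \<in> ball y r2" using dist_triangle[of y z b] b(2) n by (simp add: dist_commute)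
      qed
      ultimately have "Q (a, b, n) \<subseteq> A \<times> B" unfolding Q_def using r1(2) r2(2) by fast
      then have "Q (a, b, n) \<subseteq> U" using AB(5) by (rule subset_trans)
      then have "(a, b, n) \<in> T" unfolding T_def using a b by auto
      moreover have "(x, y) \<in> Q (a, b, n)" unfolding Q_def using a b by auto
      ultimately show "(x, y) \<in> (\<Union>t\<in>T. Q t)" by blast
    qed
  qed
qed

lemma measurable_pair_borel_separable:
  fixes f g :: "'b \<Rightarrow> 'a::metric_space"
  assumes [measurable]: "f \<in> borel_measurable M" "g \<in> borel_measurable M"
    and S: "closed S" and D: "countable D" "S \<subseteq> closure D"
  shows "(\<lambda>w. if f w \<in> S \<and> g w \<in> S then (f w, g w) else z0) \<in> borel_measurable M"
proof (rule borel_measurableI)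
  fix U :: "('a \<times> 'a) set" assume "open U"
  then obtain V where V[measurable]: "V \<in> sets (borel \<Otimes>\<^sub>M borel)" and VU: "V \<subseteq> U" "U \<inter> S \<times> S \<subseteq> V"
    using open_covered_by_borel_rectangles[OF _ D] by blast
  have [measurable]: "S \<in> sets borel" using S by simp
  have "(\<lambda>w. if f w \<in> S \<and> g w \<in> S then (f w, g w) else z0) -` U \<inter> space M
    = {w \<in> space M. if f w \<in> S \<and> g w \<in> S then (f w, g w) \<in> V else z0 \<in> U}"
    using VU by (auto split: if_splits)
  also have "\<dots> \<in> sets M" by measurable
  finally show "(\<lambda>w. if f w \<in> S \<and> g w \<in> S then (f w, g w) else z0) -` U \<inter> space M \<in> sets M" .
qed

lemma nn_integral_finite_valued:
  assumes [measurable]: "\<kappa> \<in> M \<rightarrow>\<^sub>M count_space UNIV" and n: "\<And>z. \<kappa> z < (n::nat)"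
  shows "(\<integral>\<^sup>+ z. \<phi> (\<kappa> z) \<partial>M) = (\<Sum>k<n. \<phi> k * emeasure M {z \<in> space M. \<kappa> z = k})"
proof -
  have "(\<integral>\<^sup>+ z. \<phi> (\<kappa> z) \<partial>M) = (\<integral>\<^sup>+ z. (\<Sum>k<n. \<phi> k * indicator {z \<in> space M. \<kappa> z = k} z) \<partial>M)"
  proof (rule nn_integral_cong)
    fix z assume "z \<in> space M"
    then have "(\<Sum>k<n. \<phi> k * indicator {z \<in> space M. \<kappa> z = k} z) = (\<Sum>k<n. if k = \<kappa> z then \<phi> k else 0)"
      by (intro sum.cong) (auto simp: indicator_def)
    also have "\<dots> = \<phi> (\<kappa> z)" using n by (simp add: sum.delta)
    finally show "\<phi> (\<kappa> z) = (\<Sum>k<n. \<phi> k * indicator {z \<in> space M. \<kappa> z = k} z)" by simp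
  qed
  also have "\<dots> = (\<Sum>k<n. \<phi> k * emeasure M {z \<in> space M. \<kappa> z = k})"
    by (subst nn_integral_sum) (simp_all add: nn_integral_cmult_indicator del: indicator_simps sum_mult_indicator)
  finally show ?thesis .
qed

lemma AE_pair_prob:
  assumes "prob_space M1" "prob_space M2"
  shows "AE x in M1. P x \<Longrightarrow> AE w in M1 \<Otimes>\<^sub>M M2. P (fst w)"
    and "AE y in M2. Q y \<Longrightarrow> AE w in M1 \<Otimes>\<^sub>M M2. Q (snd w)"
proof -
  interpret M1: prob_space M1 by fact
  interpret M2: prob_space M2 by fact
  show "AE w in M1 \<Otimes>\<^sub>M M2. P (fst w)" if P: "AE x in M1. P x"
  proof -
    obtain N where N: "{x\<in>space M1. \<not> P x} \<subseteq> N" "emeasure M1 N = 0" "N \<in> sets M1"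
      using P by (rule AE_E)
    show ?thesis
    proof (rule AE_I)
      show "{w \<in> space (M1 \<Otimes>\<^sub>M M2). \<not> P (fst w)} \<subseteq> N \<times> space M2"
        using N(1) by (auto simp: space_pair_measure)
    qed (use N in \<open>auto simp: M2.emeasure_pair_measure_Times\<close>)
  qed
  show "AE w in M1 \<Otimes>\<^sub>M M2. Q (snd w)" if Q: "AE y in M2. Q y"
  proof -
    obtain N where N: "{y\<in>space M2. \<not> Q y} \<subseteq> N" "emeasure M2 N = 0" "N \<in> sets M2"
      using Q by (rule AE_E)
    show ?thesis
    proof (rule AE_I)
      show "{w \<in> space (M1 \<Otimes>\<^sub>M M2). \<not> Q (snd w)} \<subseteq> space M1 \<times> N"
        using N(1) by (auto simp: space_pair_measure)
    qed (use N in \<open>auto simp: M2.emeasure_pair_measure_Times\<close>)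
  qed
qed

text \<open>
  This lemma turns a finite transport plan between classes into a coupling of the measures. The marginals
  of \<open>L\<close> are cut into pieces: \<open>\<kappa>\<close> labels the pieces of the first marginal and \<open>\<tau>\<close> those of the
  second. If the matrix \<open>c\<close> has the masses of the pieces as its row and column sums, then
  \<open>\<Sum>k l. c k l * (piece k \<otimes> piece l)\<close>, with the pieces normalised to probabilities, has the same
  marginals as \<open>L\<close>, and it transports piece \<open>k\<close> to piece \<open>l\<close> only if \<open>c k l > 0\<close>. Concretely, it is the
  law of the start of \<open>z\<close> and the end of \<open>z'\<close> when the pair \<open>(z, z')\<close> has density \<open>h\<close> with
  respect to \<open>L \<otimes> L\<close>.

  The label \<open>\<kappa>\<close> may depend on both coordinates, so a piece of the first marginal need not be its
  restriction to a set.
\<close>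

lemma recoupling:
  fixes M N :: "'a::metric_space measure" and c :: "nat \<Rightarrow> nat \<Rightarrow> real"
  assumes L: "L \<in> couplings M N"
    and S: "closed S" "emeasure M (- S) = 0" "emeasure N (- S) = 0"
    and D: "countable D" "S \<subseteq> closure D"
    and \<kappa>: "\<kappa> \<in> borel \<rightarrow>\<^sub>M count_space UNIV" "\<And>z. \<kappa> z < n"
    and \<tau>: "\<tau> \<in> borel \<rightarrow>\<^sub>M count_space UNIV" "\<And>z. \<tau> z < n"
    and c: "\<And>k l. k < n \<Longrightarrow> l < n \<Longrightarrow> 0 \<le> c k l"
    and rows: "\<And>k. k < n \<Longrightarrow> (\<Sum>l<n. c k l) = measure L {z. \<kappa> z = k}"
    and cols: "\<And>l. l < n \<Longrightarrow> (\<Sum>k<n. c k l) = measure L {z. \<tau> z = l}"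
    and pos: "\<And>k. k < n \<Longrightarrow> 0 < measure L {z. \<kappa> z = k}" "\<And>l. l < n \<Longrightarrow> 0 < measure L {z. \<tau> z = l}"
    and A: "AE z in L. P (\<kappa> z) (fst z)" and B: "AE z in L. Q (\<tau> z) (snd z)"
    and dist_le: "\<And>k l u v. k < n \<Longrightarrow> l < n \<Longrightarrow> c k l > 0 \<Longrightarrow> P k u \<Longrightarrow> Q l v \<Longrightarrow> dist u v \<le> r"
  obtains L' where "L' \<in> couplings M N" "AE z in L'. dist (fst z) (snd z) \<le> r"
proof -
  interpret L: prob_space L by (rule couplingsD(3)[OF L])
  note [simp] = couplingsD(2)[OF L]
  interpret P: pair_prob_space L L ..
  have [measurable]: "fst \<in> borel_measurable L" "snd \<in> borel_measurable L"
    by (rule coupling_fst_snd_measurable[OF L])+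
  have [measurable]: "\<kappa> \<in> L \<rightarrow>\<^sub>M count_space UNIV" "\<tau> \<in> L \<rightarrow>\<^sub>M count_space UNIV"
    unfolding coupling_measurable[OF L] by fact+
  define m where "m k = measure L {z. \<kappa> z = k}" for k
  define m' where "m' l = measure L {z. \<tau> z = l}" for l
  define \<phi> where "\<phi> k l = ennreal (c k l / (m k * m' l))" for k l
  define h where "h = (\<lambda>w. \<phi> (\<kappa> (fst w)) (\<tau> (snd w)))"
  have h[measurable]: "h \<in> borel_measurable (L \<Otimes>\<^sub>M L)"
  proof -
    have "(\<lambda>w. \<phi> k (\<tau> (snd w))) \<in> borel_measurable (L \<Otimes>\<^sub>M L)" for k
      by (rule measurable_compose_countable[where f="\<lambda>l w. \<phi> k l"]) auto
    then show ?thesis unfolding h_def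
      by (rule measurable_compose_countable[where f="\<lambda>k w. \<phi> k (\<tau> (snd w))"]) auto
  qed
  have int1: "(\<integral>\<^sup>+ z'. h (z, z') \<partial>L) = 1" for z
  proof -
    let ?k = "\<kappa> z"
    have k: "?k < n" by (rule \<kappa>)
    have "(\<integral>\<^sup>+ z'. h (z, z') \<partial>L) = (\<Sum>l<n. \<phi> ?k l * emeasure L {z. \<tau> z = l})"
      unfolding h_def using nn_integral_finite_valued[of \<tau> L n "\<phi> ?k"] \<tau>(2) by simp
    also have "\<dots> = (\<Sum>l<n. ennreal (c ?k l / m ?k))"
      using pos k c by (intro sum.cong refl)
        (auto simp: \<phi>_def L.emeasure_eq_measure m_def m'_def ennreal_mult[symmetric] less_imp_neq[symmetric])
    also have "\<dots> = ennreal ((\<Sum>l<n. c ?k l) / m ?k)"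
      using pos k c by (subst sum_ennreal) (auto simp: m_def sum_divide_distrib intro!: divide_nonneg_nonneg)
    also have "\<dots> = 1" using rows[OF k] pos(1)[OF k] by (simp add: m_def)
    finally show ?thesis .
  qed
  have int2: "(\<integral>\<^sup>+ z. h (z, z') \<partial>L) = 1" for z'
  proof -
    let ?l = "\<tau> z'"
    have l: "?l < n" by (rule \<tau>)
    have "(\<integral>\<^sup>+ z. h (z, z') \<partial>L) = (\<Sum>k<n. \<phi> k ?l * emeasure L {z. \<kappa> z = k})"
      unfolding h_def using nn_integral_finite_valued[of \<kappa> L n "\<lambda>k. \<phi> k ?l"] \<kappa>(2) by simp
    also have "\<dots> = (\<Sum>k<n. ennreal (c k ?l / m' ?l))"
      using pos l c by (intro sum.cong refl)
        (auto simp: \<phi>_def L.emeasure_eq_measure m_def m'_def ennreal_mult[symmetric] less_imp_neq[symmetric])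
    also have "\<dots> = ennreal ((\<Sum>k<n. c k ?l) / m' ?l)"
      using pos l c by (subst sum_ennreal) (auto simp: m'_def sum_divide_distrib intro!: divide_nonneg_nonneg)
    also have "\<dots> = 1" using cols[OF l] pos(2)[OF l] by (simp add: m'_def)
    finally show ?thesis .
  qed
  \<comment> \<open>Outside the separable set \<open>S\<close>, hence on a null set, a constant value keeps \<open>G\<close> measurable for
      the Borel sets of the product.\<close>
  define G where "G = (\<lambda>w::('a \<times> 'a) \<times> ('a \<times> 'a). if fst (fst w) \<in> S \<and> snd (snd w) \<in> S
    then (fst (fst w), snd (snd w)) else undefined)"
  have G[measurable]: "G \<in> (L \<Otimes>\<^sub>M L) \<rightarrow>\<^sub>M borel"
    unfolding G_def by (rule measurable_pair_borel_separable[OF _ _ S(1) D]) measurable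
  have [measurable]: "fst \<in> (borel::('a \<times> 'a) measure) \<rightarrow>\<^sub>M borel" "snd \<in> (borel::('a \<times> 'a) measure) \<rightarrow>\<^sub>M borel"
    by (auto intro!: borel_measurable_continuous_onI continuous_intros)
  have AE_S: "AE w in L \<Otimes>\<^sub>M L. fst (fst w) \<in> S \<and> snd (snd w) \<in> S"
  proof -
    have "AE z in L. fst z \<in> S" "AE z in L. snd z \<in> S"
      using coupling_AE_fst[OF L _ S(2)] coupling_AE_snd[OF L _ S(3)] S(1) by auto
    then show ?thesis
      using AE_pair_prob[OF L.prob_space_axioms L.prob_space_axioms] by (intro AE_conjI) auto
  qed
  define L' where "L' = distr (density (L \<Otimes>\<^sub>M L) h) borel G"
  have margin: "emeasure L' (f -` X) = (\<integral>\<^sup>+ w. h w * indicator X (f (fst (fst w), snd (snd w))) \<partial>(L \<Otimes>\<^sub>M L))"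
    if f[measurable]: "f \<in> borel \<rightarrow>\<^sub>M borel" and X[measurable]: "X \<in> sets borel" for f :: "'a \<times> 'a \<Rightarrow> 'a" and X
  proof -
    have fX: "f -` X \<in> sets borel" using measurable_sets[OF f X] by simp
    have "emeasure L' (f -` X) = emeasure (density (L \<Otimes>\<^sub>M L) h) (G -` (f -` X) \<inter> space (L \<Otimes>\<^sub>M L))"
      unfolding L'_def using fX by (subst emeasure_distr) auto
    also have "\<dots> = (\<integral>\<^sup>+ w. h w * indicator (G -` (f -` X) \<inter> space (L \<Otimes>\<^sub>M L)) w \<partial>(L \<Otimes>\<^sub>M L))"
      by (intro emeasure_density h measurable_sets[OF G fX])
    also have "\<dots> = (\<integral>\<^sup>+ w. h w * indicator X (f (fst (fst w), snd (snd w))) \<partial>(L \<Otimes>\<^sub>M L))"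
      using AE_S by (intro nn_integral_cong_AE, elim AE_mp, intro AE_I2)
        (auto simp: G_def indicator_def)
    finally show ?thesis .
  qed
  have fst': "emeasure L' (fst -` X) = emeasure M X" if X[measurable]: "X \<in> sets borel" for X
  proof -
    have "emeasure L' (fst -` X) = (\<integral>\<^sup>+ w. h w * indicator X (fst (fst w)) \<partial>(L \<Otimes>\<^sub>M L))"
      using margin[of fst X] X by simp
    also have "\<dots> = (\<integral>\<^sup>+ z. (\<integral>\<^sup>+ z'. h (z, z') * indicator X (fst z) \<partial>L) \<partial>L)"
      by (subst L.nn_integral_fst[symmetric]) auto
    also have "\<dots> = (\<integral>\<^sup>+ z. indicator X (fst z) \<partial>L)"
      by (intro nn_integral_cong) (subst nn_integral_multc, auto simp: int1)
    also have "\<dots> = (\<integral>\<^sup>+ x. indicator X x \<partial>(distr L borel fst))"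
      by (subst nn_integral_distr) auto
    also have "\<dots> = emeasure M X" using X by (simp add: couplingsD(4)[OF L, symmetric])
    finally show ?thesis .
  qed
  have snd': "emeasure L' (snd -` X) = emeasure N X" if X[measurable]: "X \<in> sets borel" for X
  proof -
    have "emeasure L' (snd -` X) = (\<integral>\<^sup>+ w. h w * indicator X (snd (snd w)) \<partial>(L \<Otimes>\<^sub>M L))"
      using margin[of snd X] X by simp
    also have "\<dots> = (\<integral>\<^sup>+ z'. (\<integral>\<^sup>+ z. h (z, z') * indicator X (snd z') \<partial>L) \<partial>L)"
      by (subst P.nn_integral_snd[symmetric]) auto
    also have "\<dots> = (\<integral>\<^sup>+ z. indicator X (snd z) \<partial>L)"
      by (intro nn_integral_cong) (subst nn_integral_multc, auto simp: int2)
    also have "\<dots> = (\<integral>\<^sup>+ x. indicator X x \<partial>(distr L borel snd))"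
      by (subst nn_integral_distr) auto
    also have "\<dots> = emeasure N X" using X by (simp add: couplingsD(5)[OF L, symmetric])
    finally show ?thesis .
  qed
  have setsM: "sets M = sets borel" "sets N = sets borel"
    using couplingsD(4,5)[OF L] by (metis sets_distr)+
  have setsL': "sets L' = sets borel" "space L' = UNIV" unfolding L'_def by auto
  have [measurable]: "fst \<in> L' \<rightarrow>\<^sub>M borel" "snd \<in> L' \<rightarrow>\<^sub>M borel"
    unfolding L'_def by measurable
  have "L' \<in> couplings M N"
    unfolding couplings_def borel_prob_def
  proof (safe)
    show "prob_space L'"
    proof
      have "emeasure L' (space L') = emeasure M UNIV" using fst'[of UNIV] setsL' by simp
      also have "\<dots> = emeasure L (fst -` UNIV \<inter> space L)"
        unfolding couplingsD(4)[OF L, symmetric] by (subst emeasure_distr) auto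
      also have "\<dots> = 1" using L.emeasure_space_1 by simp
      finally show "emeasure L' (space L') = 1" .
    qed
    show "distr L' borel fst = M"
      by (rule measure_eqI) (auto simp: setsM emeasure_distr setsL' fst')
    show "distr L' borel snd = N"
      by (rule measure_eqI) (auto simp: setsM emeasure_distr setsL' snd')
  qed (use setsL' in auto)
  moreover have "AE z in L'. dist (fst z) (snd z) \<le> r"
  proof -
    have "{z::'a\<times>'a. dist (fst z) (snd z) \<le> r} \<in> sets borel"
      using borel_measurable_dist_fst_snd[where 'a='a] by (simp add: borel_measurable_iff_le)
    then have "(AE z in L'. dist (fst z) (snd z) \<le> r) \<longleftrightarrow>
      (AE w in density (L \<Otimes>\<^sub>M L) h. dist (fst (G w)) (snd (G w)) \<le> r)"
      unfolding L'_def by (subst AE_distr_iff) auto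
    also have "\<dots> \<longleftrightarrow> (AE w in L \<Otimes>\<^sub>M L. 0 < h w \<longrightarrow> dist (fst (G w)) (snd (G w)) \<le> r)"
      by (rule AE_density[OF h])
    also have "\<dots>"
      using AE_S AE_pair_prob(1)[OF L.prob_space_axioms L.prob_space_axioms A]
        AE_pair_prob(2)[OF L.prob_space_axioms L.prob_space_axioms B]
    proof eventually_elim
      case (elim w)
      show ?case
      proof
        assume "0 < h w"
        then have "0 < c (\<kappa> (fst w)) (\<tau> (snd w)) / (m (\<kappa> (fst w)) * m' (\<tau> (snd w)))"
          unfolding h_def \<phi>_def by (simp add: ennreal_less_zero_iff)
        then have "0 < c (\<kappa> (fst w)) (\<tau> (snd w))"
          using c[OF \<kappa>(2) \<tau>(2), of "fst w" "snd w"] by (auto simp: less_le)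
        then have "dist (fst (fst w)) (snd (snd w)) \<le> r"
          using dist_le[OF \<kappa>(2) \<tau>(2)] elim by blast
        then show "dist (fst (G w)) (snd (G w)) \<le> r" using elim by (simp add: G_def)
      qed
    qed
    finally show ?thesis .
  qed
  ultimately show thesis by (rule that)
qed

section \<open>Consequences of couplings with small displacement\<close>

text \<open>
  The ball of radius \<open>e\<close> about a point of one support carries mass, which the coupling moves by less
  than \<open>e\<close> to the other support.
\<close>

lemma hausdorff_dist_le_of_coupling:
  fixes M N :: "'a::metric_space measure"
  assumes M: "borel_prob M" "emeasure M (- msupport M) = 0"
    and N: "borel_prob N" "emeasure N (- msupport N) = 0"
    and L: "L \<in> couplings M N" "AE z in L. dist (fst z) (snd z) < e"
    and e: "0 < e"
  shows "hausdorff_dist (msupport M) (msupport N) \<le> ennreal (2 * e)"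
proof (rule hausdorff_dist_leI)
  interpret L: prob_space L by (rule couplingsD(3)[OF L(1)])
  interpret M: prob_space M by (rule borel_probD(3)[OF M(1)])
  fix x assume x: "x \<in> msupport M"
  show "\<exists>y\<in>msupport N. dist x y \<le> 2 * e"
  proof (rule ccontr)
    assume neg: "\<not> ?thesis"
    have "AE z in L. fst z \<in> ball x e \<longrightarrow> z \<in> {}"
      using L(2) coupling_AE_snd[OF L(1) borel_msupport N(2)]
    proof eventually_elim
      case (elim z)
      then show ?case using neg dist_triangle[of x "snd z" "fst z"] by force
    qed
    then have "measure L {z. fst z \<in> ball x e} \<le> measure L {}"
      by (intro L.finite_measure_mono_AE) auto
    then have "measure M (ball x e) = 0"
      by (subst coupling_prob_fst[OF L(1), symmetric]) (auto intro: antisym)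
    then show False
      using emeasure_pos_of_msupport[OF x, of "ball x e"] e by (simp add: M.emeasure_eq_measure)
  qed
next
  interpret L: prob_space L by (rule couplingsD(3)[OF L(1)])
  interpret N: prob_space N by (rule borel_probD(3)[OF N(1)])
  fix y assume y: "y \<in> msupport N"
  show "\<exists>x\<in>msupport M. dist x y \<le> 2 * e"
  proof (rule ccontr)
    assume neg: "\<not> ?thesis"
    have "AE z in L. snd z \<in> ball y e \<longrightarrow> z \<in> {}"
      using L(2) coupling_AE_fst[OF L(1) borel_msupport M(2)]
    proof eventually_elim
      case (elim z)
      then show ?case using neg dist_triangle[of "fst z" y "snd z"] by (force simp: dist_commute)
    qed
    then have "measure L {z. snd z \<in> ball y e} \<le> measure L {}"
      by (intro L.finite_measure_mono_AE) auto
    then have "measure N (ball y e) = 0"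
      by (subst coupling_prob_snd[OF L(1), symmetric]) (auto intro: antisym)
    then show False
      using emeasure_pos_of_msupport[OF y, of "ball y e"] e by (simp add: N.emeasure_eq_measure)
  qed
qed

lemma continuous_uniform_near_compact:
  fixes \<phi> :: "'a::metric_space \<Rightarrow> real"
  assumes K: "compact K" and \<phi>: "continuous_on UNIV \<phi>" and e: "0 < e"
  obtains d where "0 < d" "\<And>x y. y \<in> K \<Longrightarrow> dist x y \<le> d \<Longrightarrow> \<bar>\<phi> x - \<phi> y\<bar> < e"
proof -
  define G where "G = {B. open B \<and> (\<forall>u\<in>B. \<forall>v\<in>B. \<bar>\<phi> u - \<phi> v\<bar> < e)}"
  have "K \<subseteq> \<Union>G"
  proof
    fix x
    let ?B = "\<phi> -` ball (\<phi> x) (e / 2)"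
    have "open ?B" using \<phi> by (intro open_vimage) auto
    then have "?B \<in> G" unfolding G_def by (auto simp: dist_real_def abs_if split: if_splits)
    moreover have "x \<in> ?B" using e by simp
    ultimately show "x \<in> \<Union>G" by blast
  qed
  then obtain r where r: "r > 0" "\<And>x. x \<in> K \<Longrightarrow> \<exists>B\<in>G. ball x r \<subseteq> B"
    using Heine_Borel_lemma[OF K, of G] unfolding G_def by blast
  show thesis
  proof (rule that[of "r / 2"])
    show "\<bar>\<phi> x - \<phi> y\<bar> < e" if yK: "y \<in> K" and xy: "dist x y \<le> r / 2" for x y
    proof -
      obtain B where "B \<in> G" "ball y r \<subseteq> B" using r(2) yK by blast
      moreover have "x \<in> ball y r" "y \<in> ball y r" using xy r(1) by (auto simp: dist_commute)
      ultimately show ?thesis unfolding G_def by blast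
    qed
  qed (use r in auto)
qed

text \<open>
  The limit lives on a compact set, near which \<open>\<phi>\<close> is uniformly continuous. So \<open>\<phi>\<close> changes
  little along the nearly diagonal part of a coupling, and the small remaining mass contributes at most
  its mass times twice the bound of \<open>\<phi>\<close>.
\<close>

lemma weak_convergence_of_nearly_diagonal:
  fixes \<mu> :: "'a::metric_space measure" and \<phi> :: "'a \<Rightarrow> real"
  assumes K: "compact K" "emeasure \<mu> (- K) = 0"
    and nd: "\<And>d h. 0 < d \<Longrightarrow> 0 < h \<Longrightarrow> eventually (\<lambda>i. nearly_diagonal (\<mu>s i) \<mu> d h) F"
    and \<phi>: "continuous_on UNIV \<phi>" "bounded (range \<phi>)"
  shows "((\<lambda>i. \<integral>x. \<phi> x \<partial>\<mu>s i) \<longlongrightarrow> (\<integral>x. \<phi> x \<partial>\<mu>)) F"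
proof (rule tendstoI)
  fix e :: real assume e: "e > 0"
  obtain B where B: "B > 0" "\<And>x. \<bar>\<phi> x\<bar> \<le> B"
    using \<phi>(2) unfolding bounded_pos by auto
  obtain d where d: "d > 0" "\<And>x y. y \<in> K \<Longrightarrow> dist x y \<le> d \<Longrightarrow> \<bar>\<phi> x - \<phi> y\<bar> < e / 2"
    using continuous_uniform_near_compact[OF K(1) \<phi>(1), of "e / 2"] e by auto
  have \<phi>_meas[measurable]: "\<phi> \<in> borel_measurable borel" using \<phi>(1) by (rule borel_measurable_continuous_onI)
  have "eventually (\<lambda>i. nearly_diagonal (\<mu>s i) \<mu> d (e / (4 * B))) F"
    using nd d(1) e B(1) by simp
  then show "eventually (\<lambda>i. dist (\<integral>x. \<phi> x \<partial>\<mu>s i) (\<integral>x. \<phi> x \<partial>\<mu>) < e) F"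
  proof eventually_elim
    case (elim i)
    then obtain L where L: "L \<in> couplings (\<mu>s i) \<mu>"
      and small: "measure L {z. dist (fst z) (snd z) > d} < e / (4 * B)"
      unfolding nearly_diagonal_def by blast
    interpret L: prob_space L by (rule couplingsD(3)[OF L])
    let ?E = "{z. dist (fst z) (snd z) > d}"
    note [measurable] = coupling_fst_snd_measurable[OF L] coupling_exceed_sets[OF L, of d]
    have int: "integrable L (\<lambda>z. \<phi> (fst z))" "integrable L (\<lambda>z. \<phi> (snd z))"
      by (rule L.integrable_const_bound[where B=B]; use B in auto)+
    have "(\<integral>x. \<phi> x \<partial>\<mu>s i) = (\<integral>z. \<phi> (fst z) \<partial>L)"
      unfolding couplingsD(4)[OF L, symmetric] by (rule integral_distr) auto
    moreover have "(\<integral>x. \<phi> x \<partial>\<mu>) = (\<integral>z. \<phi> (snd z) \<partial>L)"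
      unfolding couplingsD(5)[OF L, symmetric] by (rule integral_distr) auto
    ultimately have "dist (\<integral>x. \<phi> x \<partial>\<mu>s i) (\<integral>x. \<phi> x \<partial>\<mu>) = \<bar>\<integral>z. \<phi> (fst z) - \<phi> (snd z) \<partial>L\<bar>"
      using int by (simp add: dist_real_def)
    also have "\<dots> \<le> (\<integral>z. \<bar>\<phi> (fst z) - \<phi> (snd z)\<bar> \<partial>L)" by (rule integral_abs_bound)
    also have "\<dots> \<le> (\<integral>z. e / 2 + 2 * B * indicator ?E z \<partial>L)"
    proof (rule integral_mono_AE)
      show "AE z in L. \<bar>\<phi> (fst z) - \<phi> (snd z)\<bar> \<le> e / 2 + 2 * B * indicator ?E z"
        using coupling_AE_snd[OF L borel_compact[OF K(1)] K(2)]
      proof eventually_elim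
        case (elim z)
        show ?case
        proof (cases "z \<in> ?E")
          case True
          have "\<bar>\<phi> (fst z) - \<phi> (snd z)\<bar> \<le> B + B"
            using B(2)[of "fst z"] B(2)[of "snd z"] by linarith
          then show ?thesis using True e by simp
        next
          case False
          then show ?thesis using d(2)[OF elim, of "fst z"] by simp
        qed
      qed
    qed (use int in \<open>auto intro!: Bochner_Integration.integrable_add integrable_mult_right integrable_real_indicator simp: L.emeasure_eq_measure\<close>)
    also have "\<dots> = e / 2 + 2 * B * measure L ?E"
      by (subst Bochner_Integration.integral_add)
        (auto simp: L.prob_space[simplified couplingsD(2)[OF L]] L.emeasure_eq_measure couplingsD(2)[OF L] intro!: integrable_mult_right integrable_real_indicator)
    also have "\<dots> < e"
      using small B(1) by (simp add: field_simps)
    finally show ?case .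
  qed
qed

lemma tendsto_finite_range_eventually_eq:
  fixes f :: "'b \<Rightarrow> 'a::t1_space"
  assumes "(f \<longlongrightarrow> l) F" "finite V" "eventually (\<lambda>i. f i \<in> V) F"
  shows "eventually (\<lambda>i. f i = l) F"
proof -
  have "open (- (V - {l}))" using assms(2) by (intro open_Compl finite_imp_closed) auto
  then have "eventually (\<lambda>i. f i \<in> - (V - {l})) F"
    using assms(1) by (intro topological_tendstoD) auto
  with assms(3) show ?thesis by eventually_elim auto
qed

lemma set_dist_geD:
  assumes "ennreal e \<le> set_dist A B" "a \<in> A" "b \<in> B"
  shows "e \<le> dist a b"
proof -
  have "ennreal e \<le> ennreal (dist a b)"
    using assms unfolding set_dist_def by (meson INF_lower2 order.refl order.trans)
  then show ?thesis by (simp add: ennreal_le_iff)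
qed

lemma set_dist_geI:
  assumes "\<And>a b. a \<in> A \<Longrightarrow> b \<in> B \<Longrightarrow> e \<le> dist a b"
  shows "ennreal e \<le> set_dist A B"
  unfolding set_dist_def by (intro INF_greatest ennreal_leI assms)

lemma finite_borel_measureD:
  assumes "finite_borel_measure M"
  shows "sets M = sets borel" "space M = UNIV" "finite_measure M"
  using assms sets_eq_imp_space_eq[of M borel] unfolding finite_borel_measure_def by auto

text \<open>
  Let \<open>\<alpha>\<close> and \<open>\<beta>\<close> be parts of \<open>\<nu>\<close> at distance at least \<open>e\<close>. If a coupling moves \<open>\<nu>\<close> by less than
  \<open>e / 8\<close> to \<open>\<mu>\<close>, the images of the two parts are still so far apart that no cell of a fine partition
  meets both. Thus the mass of \<open>\<alpha>\<close> is the \<open>\<mu>\<close>-mass of a union of cells, and there are only finitely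
  many such unions. A convergent sequence of masses with values in a finite set is
  eventually constant.
\<close>

lemma separated_part_mass_finitely_many_values:
  fixes \<mu> :: "'a::metric_space measure" and e :: real
  assumes K: "compact K" "K \<noteq> {}" "emeasure \<mu> (- K) = 0" and e: "0 < e"
  obtains V :: "real set" where "finite V"
    "\<And>\<nu> \<alpha> \<beta> L. \<lbrakk>sets \<nu> = sets borel; compactly_supported \<nu>;
      L \<in> couplings \<nu> \<mu>; AE z in L. dist (fst z) (snd z) < e / 8;
      finite_borel_measure \<alpha>; finite_borel_measure \<beta>;
      \<And>A. A \<in> sets borel \<Longrightarrow> emeasure \<nu> A = emeasure \<alpha> A + emeasure \<beta> A;
      ennreal e \<le> set_dist (msupport \<alpha>) (msupport \<beta>)\<rbrakk> \<Longrightarrow> measure \<alpha> UNIV \<in> V"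
proof -
  define d where "d = e / 8"
  have d: "0 < d" using e unfolding d_def by simp
  obtain n y q where q: "q \<in> borel \<rightarrow>\<^sub>M count_space UNIV" "\<And>x. q x < (n::nat)"
    "\<And>x z. z \<in> K \<Longrightarrow> dist x z \<le> d \<Longrightarrow> dist x (y (q x)) < 2 * d"
    using nearest_point_net[OF K(1,2) d] by metis
  show thesis
  proof (rule that[of "(\<lambda>J. measure \<mu> (q -` J)) ` Pow {..<n}"])
    fix \<nu> \<alpha> \<beta> :: "'a measure" and L
    assume \<nu>: "sets \<nu> = sets borel" "compactly_supported \<nu>"
      and L: "L \<in> couplings \<nu> \<mu>" "AE z in L. dist (fst z) (snd z) < e / 8"
      and \<alpha>: "finite_borel_measure \<alpha>" and \<beta>: "finite_borel_measure \<beta>"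
      and sum: "\<And>A. A \<in> sets borel \<Longrightarrow> emeasure \<nu> A = emeasure \<alpha> A + emeasure \<beta> A"
      and sep: "ennreal e \<le> set_dist (msupport \<alpha>) (msupport \<beta>)"
    interpret L: prob_space L by (rule couplingsD(3)[OF L(1)])
    let ?K = "msupport \<nu>" and ?A = "msupport \<alpha>" and ?B = "msupport \<beta>"
    have K': "compact ?K" "emeasure \<nu> (- ?K) = 0"
      using \<nu>(2) unfolding compactly_supported_def by auto
    obtain D where D: "countable D" "?K \<subseteq> closure D" using compact_countable_dense[OF K'(1)] by blast
    have "- ?K \<in> sets borel" using borel_msupport[of \<nu>] by auto
    then have "emeasure \<alpha> (- ?K) = 0" "emeasure \<beta> (- ?K) = 0" using sum[of "- ?K"] K'(2) by auto
    then have null: "emeasure \<alpha> (- ?A) = 0" "emeasure \<beta> (- ?B) = 0"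
      using emeasure_compl_msupport[OF _ closed_msupport _ D] finite_borel_measureD(1)[OF \<alpha>]
        finite_borel_measureD(1)[OF \<beta>] by auto
    have disj: "?A \<subseteq> - ?B" using set_dist_geD[OF sep] e by force
    have "emeasure \<beta> ?A = 0"
      using emeasure_mono[OF disj, of \<beta>] null(2) borel_comp[OF borel_msupport[of \<beta>]]
        finite_borel_measureD(1)[OF \<beta>] by auto
    moreover have "emeasure \<alpha> UNIV = emeasure \<alpha> ?A"
    proof -
      have "emeasure \<alpha> UNIV = emeasure \<alpha> ?A + emeasure \<alpha> (- ?A)"
        using borel_msupport[of \<alpha>] finite_borel_measureD(1)[OF \<alpha>]
        by (subst plus_emeasure) auto
      then show ?thesis using null by simp
    qed
    ultimately have mass: "measure \<alpha> UNIV = measure \<nu> ?A"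
      using sum[OF borel_msupport[of \<alpha>]] by (simp add: measure_def)
    have "emeasure \<nu> (- (?A \<union> ?B)) = 0"
    proof -
      have "emeasure \<alpha> (- (?A \<union> ?B)) \<le> emeasure \<alpha> (- ?A)"
        using borel_msupport[of \<alpha>] finite_borel_measureD(1)[OF \<alpha>] by (intro emeasure_mono) auto
      moreover have "emeasure \<beta> (- (?A \<union> ?B)) \<le> emeasure \<beta> (- ?B)"
        using borel_msupport[of \<beta>] finite_borel_measureD(1)[OF \<beta>] by (intro emeasure_mono) auto
      moreover have "- (?A \<union> ?B) \<in> sets borel" by (intro borel_comp sets.Un borel_msupport)
      ultimately show ?thesis using null sum[of "- (?A \<union> ?B)"] by auto
    qed
    then have AB: "AE z in L. fst z \<in> ?A \<union> ?B"
      using borel_msupport[of \<alpha>] borel_msupport[of \<beta>] by (intro coupling_AE_fst[OF L(1)]) auto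
    \<comment> \<open>The cells reached from the support of \<open>\<alpha>\<close>. A point moved less than \<open>d\<close> into such a cell is within
        \<open>d + 4 * d + d\<close> of that support, which is less than the gap \<open>8 * d\<close>.\<close>
    define J where "J = q ` {v \<in> K. \<exists>u\<in>?A. dist u v < d}"
    have J: "J \<in> Pow {..<n}" unfolding J_def using q(2) by auto
    have "AE z in L. fst z \<in> ?A \<longleftrightarrow> snd z \<in> q -` J"
      using AB L(2) coupling_AE_snd[OF L(1) borel_compact[OF K(1)] K(3)]
    proof eventually_elim
      case (elim z)
      show ?case
      proof
        assume "fst z \<in> ?A"
        then show "snd z \<in> q -` J" using elim unfolding J_def d_def by auto
      next
        assume "snd z \<in> q -` J"
        then obtain u v where uv: "v \<in> K" "u \<in> ?A" "dist u v < d" "q (snd z) = q v"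
          unfolding J_def by auto
        show "fst z \<in> ?A"
        proof (rule ccontr)
          assume "fst z \<notin> ?A"
          then have "fst z \<in> ?B" using elim by blast
          then have "8 * d \<le> dist u (fst z)" using set_dist_geD[OF sep uv(2)] unfolding d_def by simp
          moreover have "dist v (y (q v)) < 2 * d" "dist (snd z) (y (q v)) < 2 * d"
            using q(3)[of v v] q(3)[of "snd z" "snd z"] uv elim d by auto
          moreover have "dist (fst z) (snd z) < d" using elim unfolding d_def by simp
          ultimately show False
            using uv(3) dist_triangle[of u "fst z" v] dist_triangle[of v "fst z" "snd z"]
              dist_triangle2[of v "snd z" "y (q v)"] d by (simp add: dist_commute)
        qed
      qed
    qed
    then have "measure L {z. fst z \<in> ?A} = measure L {z. snd z \<in> q -` J}"
    proof (intro L.finite_measure_eq_AE)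
      show "{z. fst z \<in> ?A} \<in> sets L"
        using measurable_sets[OF coupling_fst_snd_measurable(1)[OF L(1)] borel_msupport[of \<alpha>]]
        by (simp add: couplingsD(2)[OF L(1)] vimage_def)
      show "{z. snd z \<in> q -` J} \<in> sets L"
        using measurable_sets[OF coupling_fst_snd_measurable(2)[OF L(1)], of "q -` J"]
          measurable_sets[OF q(1), of J]
        by (simp add: couplingsD(2)[OF L(1)] vimage_def)
    qed auto
    then have "measure \<nu> ?A = measure \<mu> (q -` J)"
      using coupling_prob_fst[OF L(1) borel_msupport[of \<alpha>]]
        coupling_prob_snd[OF L(1), of "q -` J"] measurable_sets[OF q(1), of J] by simp
    with mass J show "measure \<alpha> UNIV \<in> (\<lambda>J. measure \<mu> (q -` J)) ` Pow {..<n}" by auto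
  qed auto
qed

section \<open>Masses of clusters\<close>

lemma emeasure_density_indicator:
  assumes "Q \<in> sets M" "A \<in> sets M"
  shows "emeasure (density M (\<lambda>x. ennreal (indicator Q x))) A = emeasure M (Q \<inter> A)"
  using emeasure_restricted[OF assms] by (simp add: ennreal_indicator)

text \<open>
  Almost everywhere the indicator of \<open>Q\<close> agrees with the continuous function \<open>\<theta>\<close>, and the distance to \<open>ctr\<close>
  agrees with its truncation at \<open>r\<close>. So both parts of \<^const>\<open>W_conv\<close> for the restrictions to \<open>Q\<close>
  are integrals of bounded continuous functions against the original measures.
\<close>

lemma W_conv_restrict:
  fixes \<mu> :: "'a::metric_space measure" and \<theta> :: "'a \<Rightarrow> real"
  assumes \<mu>s: "\<And>i. borel_prob (\<mu>s i)" and \<mu>: "borel_prob \<mu>" and p: "1 \<le> p"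
    and K: "compact K" "emeasure \<mu> (- K) = 0"
    and nd: "\<And>d h. 0 < d \<Longrightarrow> 0 < h \<Longrightarrow> eventually (\<lambda>i. nearly_diagonal (\<mu>s i) \<mu> d h) sequentially"
    and Q: "Q \<in> sets borel"
    and \<theta>: "continuous_on UNIV \<theta>" "\<And>x. 0 \<le> \<theta> x" "\<And>x. \<theta> x \<le> 1"
    and good: "eventually (\<lambda>i. AE x in \<mu>s i. indicator Q x = \<theta> x \<and> dist x ctr \<le> r) sequentially"
    and good': "AE x in \<mu>. indicator Q x = \<theta> x \<and> dist x ctr \<le> r"
    and \<alpha>s: "eventually (\<lambda>i. \<alpha>s i = density (\<mu>s i) (\<lambda>x. ennreal (indicator Q x))) sequentially"
  shows "W_conv p \<alpha>s (density \<mu> (\<lambda>x. ennreal (indicator Q x)))"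
proof -
  have [measurable]: "\<theta> \<in> borel_measurable borel" using \<theta>(1) by (rule borel_measurable_continuous_onI)
  have [measurable]: "(\<lambda>x. dist x ctr) \<in> borel_measurable borel"
    by (intro borel_measurable_continuous_onI continuous_intros)
  have meas: "f \<in> borel_measurable M" if "f \<in> borel_measurable borel" "borel_prob M"
    for f :: "'a \<Rightarrow> real" and M
    using measurable_cong_sets[OF borel_probD(1)[OF that(2)] refl] that(1) by blast
  have QM: "Q \<in> sets M" if "borel_prob M" for M :: "'a measure"
    using Q borel_probD(1)[OF that] by simp
  define \<psi> where "\<psi> = (\<lambda>x. \<theta> x * min (dist x ctr powr p) (r powr p))"
  have \<psi>_cont: "continuous_on UNIV \<psi>"
    unfolding \<psi>_def using \<theta>(1) p
    by (intro continuous_intros continuous_on_min continuous_on_powr') auto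
  have \<psi>_bd: "0 \<le> \<psi> x" "\<psi> x \<le> r powr p" for x
  proof -
    show "0 \<le> \<psi> x" unfolding \<psi>_def using \<theta> by simp
    have "\<psi> x \<le> 1 * (r powr p)" unfolding \<psi>_def using \<theta> by (intro mult_mono) auto
    then show "\<psi> x \<le> r powr p" by simp
  qed
  have [measurable]: "\<psi> \<in> borel_measurable borel" using \<psi>_cont by (rule borel_measurable_continuous_onI)
  have bochner: "(\<integral>x. \<phi> x \<partial>density M (\<lambda>x. ennreal (indicator Q x))) = (\<integral>x. \<theta> x * \<phi> x \<partial>M)"
    if M: "borel_prob M" "AE x in M. indicator Q x = \<theta> x \<and> dist x ctr \<le> r"
      and \<phi>: "continuous_on UNIV \<phi>" for M and \<phi> :: "'a \<Rightarrow> real"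
  proof -
    have [measurable]: "\<phi> \<in> borel_measurable M" "\<theta> \<in> borel_measurable M" "Q \<in> sets M"
      using \<phi> \<theta>(1) by (simp_all add: meas[OF _ M(1)] QM[OF M(1)] borel_measurable_continuous_onI)
    have "(\<integral>x. \<phi> x \<partial>density M (\<lambda>x. ennreal (indicator Q x))) = (\<integral>x. indicator Q x * \<phi> x \<partial>M)"
      by (subst integral_density) auto
    also have "\<dots> = (\<integral>x. \<theta> x * \<phi> x \<partial>M)"
      using M(2) by (intro integral_cong_AE) auto
    finally show ?thesis .
  qed
  have moment: "(\<integral>\<^sup>+ x. ennreal (dist x ctr powr p) \<partial>density M (\<lambda>x. ennreal (indicator Q x)))
      = ennreal (\<integral>x. \<psi> x \<partial>M)"
    if M: "borel_prob M" "AE x in M. indicator Q x = \<theta> x \<and> dist x ctr \<le> r" for M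
  proof -
    interpret prob_space M by (rule borel_probD(3)[OF M(1)])
    have [measurable]: "\<psi> \<in> borel_measurable M" "(\<lambda>x. dist x ctr) \<in> borel_measurable M" "Q \<in> sets M"
      by (intro meas[OF _ M(1)] QM[OF M(1)]; measurable)+
    have "(\<integral>\<^sup>+ x. ennreal (dist x ctr powr p) \<partial>density M (\<lambda>x. ennreal (indicator Q x)))
      = (\<integral>\<^sup>+ x. ennreal (indicator Q x) * ennreal (dist x ctr powr p) \<partial>M)"
      by (subst nn_integral_density) auto
    also have "\<dots> = (\<integral>\<^sup>+ x. ennreal (\<psi> x) \<partial>M)"
    proof (rule nn_integral_cong_AE)
      show "AE x in M. ennreal (indicator Q x) * ennreal (dist x ctr powr p) = ennreal (\<psi> x)"
        using M(2)
      proof eventually_elim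
        case (elim x)
        then have "dist x ctr powr p \<le> r powr p" using p by (intro powr_mono2) auto
        then have "\<psi> x = \<theta> x * dist x ctr powr p" unfolding \<psi>_def by simp
        moreover have "indicator Q x = \<theta> x" using elim by simp
        ultimately show ?case using \<theta>(2) by (simp add: ennreal_mult)
      qed
    qed
    also have "\<dots> = ennreal (\<integral>x. \<psi> x \<partial>M)"
      using \<psi>_bd by (intro nn_integral_eq_integral integrable_const_bound[where B="r powr p"]) auto
    finally show ?thesis .
  qed
  show ?thesis
    unfolding W_conv_def
  proof (intro conjI allI impI exI[of _ ctr])
    fix \<phi> :: "'a \<Rightarrow> real" assume \<phi>: "continuous_on UNIV \<phi> \<and> bounded (range \<phi>)"
    obtain B where B: "\<And>x. \<bar>\<phi> x\<bar> \<le> B"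
      using \<phi> unfolding bounded_pos by auto
    have "bounded (range (\<lambda>x. \<theta> x * \<phi> x))"
    proof (rule boundedI)
      fix t assume "t \<in> range (\<lambda>x. \<theta> x * \<phi> x)"
      then obtain x where "t = \<theta> x * \<phi> x" by blast
      moreover have "\<theta> x * \<bar>\<phi> x\<bar> \<le> 1 * B" using B[of x] \<theta>(2,3)[of x] by (intro mult_mono) auto
      ultimately show "norm t \<le> B" using \<theta>(2)[of x] by (simp add: abs_mult)
    qed
    then have "(\<lambda>i. \<integral>x. \<theta> x * \<phi> x \<partial>\<mu>s i) \<longlonglongrightarrow> (\<integral>x. \<theta> x * \<phi> x \<partial>\<mu>)"
      using \<phi> \<theta>(1) by (intro weak_convergence_of_nearly_diagonal[OF K nd] continuous_intros) auto
    moreover have "eventually (\<lambda>i. (\<integral>x. \<theta> x * \<phi> x \<partial>\<mu>s i) = (\<integral>x. \<phi> x \<partial>\<alpha>s i)) sequentially"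
      using good \<alpha>s by eventually_elim (use bochner \<mu>s \<phi> in auto)
    ultimately show "(\<lambda>i. \<integral>x. \<phi> x \<partial>\<alpha>s i) \<longlonglongrightarrow>
      (\<integral>x. \<phi> x \<partial>density \<mu> (\<lambda>x. ennreal (indicator Q x)))"
      using bochner[OF \<mu> good', of \<phi>] \<phi> by (auto elim: Lim_transform_eventually)
  next
    have "bounded (range \<psi>)" using \<psi>_bd by (intro boundedI[where B="r powr p"]) auto
    then have "(\<lambda>i. ennreal (\<integral>x. \<psi> x \<partial>\<mu>s i)) \<longlonglongrightarrow> ennreal (\<integral>x. \<psi> x \<partial>\<mu>)"
      by (intro tendsto_ennrealI weak_convergence_of_nearly_diagonal[OF K nd] \<psi>_cont) auto
    moreover have "eventually (\<lambda>i. ennreal (\<integral>x. \<psi> x \<partial>\<mu>s i) =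
        (\<integral>\<^sup>+ x. ennreal (dist x ctr powr p) \<partial>\<alpha>s i)) sequentially"
      using good \<alpha>s by eventually_elim (use moment \<mu>s in auto)
    ultimately show "(\<lambda>i. \<integral>\<^sup>+ x. ennreal (dist x ctr powr p) \<partial>\<alpha>s i) \<longlonglongrightarrow>
      (\<integral>\<^sup>+ x. ennreal (dist x ctr powr p) \<partial>density \<mu> (\<lambda>x. ennreal (indicator Q x)))"
      using moment[OF \<mu> good'] by (auto elim: Lim_transform_eventually)
    show "(\<integral>\<^sup>+ x. ennreal (dist x ctr powr p) \<partial>density \<mu> (\<lambda>x. ennreal (indicator Q x))) < \<infinity>"
      using moment[OF \<mu> good'] by simp
  qed
qed

text \<open>
  The condition on separated splittings, which restricts the sequence alone and not its limit; naming
  it lets the lemmas below assume it.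
\<close>

definition splits_keep_mass :: "real \<Rightarrow> (nat \<Rightarrow> 'a::metric_space measure) \<Rightarrow> bool" where
  "splits_keep_mass p \<mu>s \<longleftrightarrow>
    (\<forall>(\<mu>s1 :: nat \<Rightarrow> 'a measure) (\<mu>s2 :: nat \<Rightarrow> 'a measure) (\<mu>1 :: 'a measure) (\<mu>2 :: 'a measure).
      (\<forall>i. finite_borel_measure (\<mu>s1 i) \<and> finite_borel_measure (\<mu>s2 i)) \<and>
      finite_borel_measure \<mu>1 \<and> finite_borel_measure \<mu>2 \<and>
      (\<forall>i. \<forall>A\<in>sets borel. emeasure (\<mu>s i) A = emeasure (\<mu>s1 i) A + emeasure (\<mu>s2 i) A) \<and>
      W_conv p \<mu>s1 \<mu>1 \<and> W_conv p \<mu>s2 \<mu>2 \<and>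
      (INF i. set_dist (msupport (\<mu>s1 i)) (msupport (\<mu>s2 i))) > 0 \<longrightarrow>
      (\<exists>i0. \<forall>i\<ge>i0. emeasure (\<mu>s1 i) UNIV = emeasure \<mu>1 UNIV))"

lemma finite_borel_measure_density_indicator:
  assumes M: "borel_prob M" and Q: "Q \<in> sets borel"
  shows "finite_borel_measure (density M (\<lambda>x. ennreal (indicator Q x)))"
proof -
  interpret prob_space M by (rule borel_probD(3)[OF M])
  have "emeasure (density M (\<lambda>x. ennreal (indicator Q x))) UNIV = emeasure M (Q \<inter> UNIV)"
    using Q by (intro emeasure_density_indicator) (auto simp: borel_probD[OF M])
  then show ?thesis
    using M unfolding finite_borel_measure_def
    by (auto simp: borel_probD[OF M] intro!: finite_measureI)
qed

text \<open>
  The splitting condition, applied to the restrictions of the measures to a union of clusters \<open>Q\<close> and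
  to its complement. Near \<open>K\<close> these two sets are separated by a gap, so a cut-off function between \<open>F1\<close>
  and \<open>F2\<close> shows that the restrictions converge.
\<close>

lemma cluster_mass_eventually_eq:
  fixes \<mu> :: "'a::metric_space measure" and gap :: real
  assumes \<mu>s: "\<And>i. borel_prob (\<mu>s i)" "\<And>i. compactly_supported (\<mu>s i)"
    and \<mu>: "borel_prob \<mu>" and p: "1 \<le> p"
    and K: "compact K" "K \<noteq> {}" "emeasure \<mu> (- K) = 0"
    and nd: "\<And>d h. 0 < d \<Longrightarrow> 0 < h \<Longrightarrow> eventually (\<lambda>i. nearly_diagonal (\<mu>s i) \<mu> d h) sequentially"
    and splits: "splits_keep_mass p \<mu>s"
    and close: "eventually (\<lambda>i. \<forall>x\<in>msupport (\<mu>s i). \<exists>z\<in>K. dist x z < d) sequentially" and d: "0 < d"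
    and Q: "Q \<in> sets borel" and F: "closed F1" "closed F2"
    and QF: "\<And>x z. z \<in> K \<Longrightarrow> dist x z < d \<Longrightarrow> x \<in> Q \<Longrightarrow> x \<in> F1"
      "\<And>x z. z \<in> K \<Longrightarrow> dist x z < d \<Longrightarrow> x \<notin> Q \<Longrightarrow> x \<in> F2"
    and gap: "0 < gap" "\<And>a b. a \<in> F1 \<Longrightarrow> b \<in> F2 \<Longrightarrow> gap \<le> dist a b"
  shows "eventually (\<lambda>i. measure (\<mu>s i) Q = measure \<mu> Q) sequentially"
proof -
  define good where "good i \<longleftrightarrow> (\<forall>x\<in>msupport (\<mu>s i). \<exists>z\<in>K. dist x z < d)" for i
  define \<rho> where "\<rho> X M = density M (\<lambda>x. ennreal (indicator X x))" for X and M :: "'a measure"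
  \<comment> \<open>The condition demands a gap for all indices. The finitely many measures that stray from \<open>K\<close> are
      split trivially, and the null measure has empty support, at distance \<open>\<infinity>\<close> from everything.\<close>
  define \<alpha> where "\<alpha> i = (if good i then \<rho> Q (\<mu>s i) else \<mu>s i)" for i
  define \<beta> where "\<beta> i = (if good i then \<rho> (- Q) (\<mu>s i) else null_measure borel)" for i
  have Q': "- Q \<in> sets borel" using Q by auto
  have full: "emeasure (\<mu>s i) (- msupport (\<mu>s i)) = 0" for i
    using \<mu>s(2)[of i] unfolding compactly_supported_def by auto
  define \<theta> where "\<theta> = (\<lambda>x. if F1 = {} then 0 else max 0 (1 - infdist x F1 / gap))"
  have \<theta>: "continuous_on UNIV \<theta>" "\<And>x. 0 \<le> \<theta> x" "\<And>x. \<theta> x \<le> 1"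
    unfolding \<theta>_def using gap(1)
    by (cases "F1 = {}"; auto intro!: continuous_intros continuous_on_max divide_nonneg_nonneg infdist_nonneg)+
  have \<theta>1: "\<theta> x = 1" if "x \<in> F1" for x unfolding \<theta>_def using that by auto
  have \<theta>0: "\<theta> x = 0" if "x \<in> F2" for x
  proof (cases "F1 = {}")
    case False
    then have "gap \<le> infdist x F1"
      unfolding infdist_notempty[OF False] using gap(2) that
      by (intro cINF_greatest) (auto simp: dist_commute)
    then show ?thesis unfolding \<theta>_def using gap(1) by (simp add: field_simps)
  qed (simp add: \<theta>_def)
  have near: "indicator Q x = \<theta> x" "indicator (- Q) x = 1 - \<theta> x" if "z \<in> K" "dist x z < d" for x z
    using QF[OF that] \<theta>1[of x] \<theta>0[of x] by (auto simp: indicator_def)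
  obtain x0 r where r: "\<And>z. z \<in> K \<Longrightarrow> dist z x0 \<le> r"
    using compact_imp_bounded[OF K(1)] unfolding bounded_def by (auto simp: dist_commute)
  have ae: "AE x in \<mu>s i. \<exists>z\<in>K. dist x z < d" if "good i" for i
  proof -
    have "AE x in \<mu>s i. x \<in> msupport (\<mu>s i)"
      using full borel_msupport[of "\<mu>s i"] by (intro AE_I[of _ _ "- msupport (\<mu>s i)"]) (auto simp: borel_probD[OF \<mu>s(1)])
    then show ?thesis by eventually_elim (use that good_def in auto)
  qed
  have ae': "AE x in \<mu>. \<exists>z\<in>K. dist x z < d"
  proof -
    have "AE x in \<mu>. x \<in> K"
      using K borel_compact[OF K(1)] by (intro AE_I[of _ _ "- K"]) (auto simp: borel_probD[OF \<mu>])
    then show ?thesis by eventually_elim (metis d dist_self)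
  qed
  have dist_r: "dist x x0 \<le> r + d" if "z \<in> K" "dist x z < d" for x z
    using r[OF that(1)] that(2) dist_triangle[of x x0 z] by linarith
  have ev_good: "eventually good sequentially" using close unfolding good_def .
  have conv1: "W_conv p \<alpha> (\<rho> Q \<mu>)"
    unfolding \<rho>_def
  proof (rule W_conv_restrict[OF \<mu>s(1) \<mu> p K(1,3) nd Q \<theta>, where ctr=x0 and r="r + d"])
    show "\<forall>\<^sub>F i in sequentially. AE x in \<mu>s i. indicator Q x = \<theta> x \<and> dist x x0 \<le> r + d"
      using ev_good
    proof eventually_elim
      case (elim i)
      from ae[OF elim] show ?case by eventually_elim (use near(1) dist_r in blast)
    qed
    show "AE x in \<mu>. indicator Q x = \<theta> x \<and> dist x x0 \<le> r + d"
      using ae' by eventually_elim (use near(1) dist_r in blast)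
    show "\<forall>\<^sub>F i in sequentially. \<alpha> i = density (\<mu>s i) (\<lambda>x. ennreal (indicator Q x))"
      using ev_good by eventually_elim (simp add: \<alpha>_def \<rho>_def)
  qed
  have conv2: "W_conv p \<beta> (\<rho> (- Q) \<mu>)"
    unfolding \<rho>_def
  proof (rule W_conv_restrict[OF \<mu>s(1) \<mu> p K(1,3) nd Q', where ctr=x0 and r="r + d" and \<theta>="\<lambda>x. 1 - \<theta> x"])
    show "continuous_on UNIV (\<lambda>x. 1 - \<theta> x)" using \<theta>(1) by (intro continuous_intros)
    show "\<forall>\<^sub>F i in sequentially. AE x in \<mu>s i. indicator (- Q) x = 1 - \<theta> x \<and> dist x x0 \<le> r + d"
      using ev_good
    proof eventually_elim
      case (elim i)
      from ae[OF elim] show ?case by eventually_elim (use near(2) dist_r in blast)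
    qed
    show "AE x in \<mu>. indicator (- Q) x = 1 - \<theta> x \<and> dist x x0 \<le> r + d"
      using ae' by eventually_elim (use near(2) dist_r in blast)
    show "\<forall>\<^sub>F i in sequentially. \<beta> i = density (\<mu>s i) (\<lambda>x. ennreal (indicator (- Q) x))"
      using ev_good by eventually_elim (simp add: \<beta>_def \<rho>_def)
  qed (use \<theta> in auto)
  have \<rho>_em: "emeasure (\<rho> X M) A = emeasure M (X \<inter> A)" if "borel_prob M" "X \<in> sets borel" "A \<in> sets borel" for X M A
    unfolding \<rho>_def using that by (intro emeasure_density_indicator) (auto simp: borel_probD)
  have \<rho>_fin: "finite_borel_measure (\<rho> X M)" if "borel_prob M" "X \<in> sets borel" for X M
    unfolding \<rho>_def using that by (rule finite_borel_measure_density_indicator)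
  have fin: "finite_borel_measure (\<alpha> i)" "finite_borel_measure (\<beta> i)" for i
  proof -
    have "finite_borel_measure (\<mu>s i)"
      using \<mu>s(1)[of i] unfolding finite_borel_measure_def borel_prob_def
      by (auto intro: prob_space.finite_measure)
    then show "finite_borel_measure (\<alpha> i)" unfolding \<alpha>_def using \<rho>_fin[OF \<mu>s(1) Q] by auto
    have "finite_borel_measure (null_measure (borel :: 'a measure))"
      unfolding finite_borel_measure_def by (auto intro!: finite_measureI)
    then show "finite_borel_measure (\<beta> i)" unfolding \<beta>_def using \<rho>_fin[OF \<mu>s(1) Q'] by auto
  qed
  have sum: "emeasure (\<mu>s i) A = emeasure (\<alpha> i) A + emeasure (\<beta> i) A" if A: "A \<in> sets borel" for i A
  proof (cases "good i")
    case True
    have "emeasure (\<mu>s i) A = emeasure (\<mu>s i) (Q \<inter> A) + emeasure (\<mu>s i) (- Q \<inter> A)"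
      using A Q by (subst plus_emeasure) (auto simp: borel_probD[OF \<mu>s(1)] intro!: arg_cong[where f="emeasure (\<mu>s i)"])
    then show ?thesis using True \<rho>_em[OF \<mu>s(1) Q A] \<rho>_em[OF \<mu>s(1) Q' A] by (simp add: \<alpha>_def \<beta>_def)
  qed (simp add: \<alpha>_def \<beta>_def)
  have gap_i: "ennreal gap \<le> set_dist (msupport (\<alpha> i)) (msupport (\<beta> i))" for i
  proof (cases "good i")
    case True
    have sub: "msupport (\<rho> X (\<mu>s i)) \<subseteq> F0"
      if X: "X \<in> sets borel" "closed F0" and XF: "\<And>x z. z \<in> K \<Longrightarrow> dist x z < d \<Longrightarrow> x \<in> X \<Longrightarrow> x \<in> F0" for X F0
    proof (rule msupport_subset[OF X(2)])
      have "X \<inter> - F0 \<subseteq> - msupport (\<mu>s i)" using True XF unfolding good_def by blast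
      then have "emeasure (\<mu>s i) (X \<inter> - F0) \<le> emeasure (\<mu>s i) (- msupport (\<mu>s i))"
        using borel_comp[OF borel_msupport] by (intro emeasure_mono) (auto simp: borel_probD[OF \<mu>s(1)])
      then show "emeasure (\<rho> X (\<mu>s i)) (- F0) = 0"
        using \<rho>_em[OF \<mu>s(1) X(1), of "- F0" i] X(2) full by auto
    qed
    show ?thesis
    proof (rule set_dist_geI)
      fix a b assume ab: "a \<in> msupport (\<alpha> i)" "b \<in> msupport (\<beta> i)"
      have "a \<in> F1" using ab(1) True sub[OF Q F(1)] QF(1) by (auto simp: \<alpha>_def)
      moreover have "b \<in> F2" using ab(2) True sub[OF Q' F(2)] QF(2) by (auto simp: \<beta>_def)
      ultimately show "gap \<le> dist a b" by (rule gap(2))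
    qed
  next
    case False
    then have "msupport (\<beta> i) = {}"
      using msupport_subset[of "{}" "null_measure borel"] by (auto simp: \<beta>_def)
    then show ?thesis by (intro set_dist_geI) auto
  qed
  have "(INF i. set_dist (msupport (\<alpha> i)) (msupport (\<beta> i))) > 0"
  proof (rule less_le_trans)
    show "0 < ennreal gap" using gap(1) by simp
    show "ennreal gap \<le> (INF i. set_dist (msupport (\<alpha> i)) (msupport (\<beta> i)))"
      by (intro INF_greatest gap_i)
  qed
  then have "\<exists>i0. \<forall>i\<ge>i0. emeasure (\<alpha> i) UNIV = emeasure (\<rho> Q \<mu>) UNIV"
    using splits[unfolded splits_keep_mass_def] fin \<rho>_fin[OF \<mu> Q] \<rho>_fin[OF \<mu> Q'] sum conv1 conv2
    by blast
  then have "eventually (\<lambda>i. emeasure (\<alpha> i) UNIV = emeasure (\<rho> Q \<mu>) UNIV) sequentially"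
    unfolding eventually_sequentially .
  with ev_good show ?thesis
  proof eventually_elim
    case (elim i)
    then have "emeasure (\<mu>s i) Q = emeasure \<mu> Q"
      using \<rho>_em[OF \<mu>s(1) Q, of UNIV i] \<rho>_em[OF \<mu> Q, of UNIV] by (simp add: \<alpha>_def)
    then show ?case by (simp add: measure_def)
  qed
qed

section \<open>The equivalence\<close>

lemma (in finite_measure) sum_measure_fibres:
  assumes "f \<in> M \<rightarrow>\<^sub>M count_space UNIV" "finite C" "space M = UNIV"
  shows "(\<Sum>k\<in>C. measure M {z. f z = k}) = measure M {z. f z \<in> C}"
proof -
  have "measure M (\<Union>k\<in>C. {z. f z = k}) = (\<Sum>k\<in>C. measure M {z. f z = k})"
  proof (rule finite_measure_finite_Union[OF assms(2)])
    have "f -` {k} \<inter> space M \<in> sets M" for k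
      using assms(1) by (rule measurable_sets) simp
    then show "(\<lambda>k. {z. f z = k}) ` C \<subseteq> sets M" using assms(3) by (auto simp: vimage_def)
  qed (auto simp: disjoint_family_on_def)
  moreover have "(\<Union>k\<in>C. {z. f z = k}) = {z. f z \<in> C}" by auto
  ultimately show ?thesis by simp
qed

text \<open>
  Take a net of the support of \<open>\<mu>\<close> and join centres at distance at most \<open>5 * d\<close>. The connected components
  of this graph cut the supports into clusters that are at distance at least \<open>d\<close> from each other, so
  eventually \<open>\<mu>s i\<close> and \<open>\<mu>\<close> give the same mass to each cluster.

  Start from a coupling whose exceptional pairs, those at distance more than \<open>d\<close>, have small mass.
  Label a pair by the cell of its end point or, if it is exceptional, by the cell of its starting
  point. The labels give classes of starting points of masses \<open>m\<close> close to the cell masses \<open>nm\<close> of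
  \<open>\<mu>\<close>, and with the same total over each cluster. A small flow along the edges of the graph balances \<open>m\<close>
  and \<open>nm\<close>. Since every cell has mass at least \<open>b > 0\<close>, the flow never takes more out of
  a class than it contains; so each particle moves along at most one edge, a distance of at most
  \<open>10 * d\<close>.
\<close>

lemma W_inf_eventually_le:
  fixes \<mu> :: "'a::metric_space measure" and d :: real
  assumes \<mu>s: "\<And>i. borel_prob (\<mu>s i)" "\<And>i. compactly_supported (\<mu>s i)"
    and \<mu>: "borel_prob \<mu>" and p: "1 \<le> p"
    and K: "compact (msupport \<mu>)" "emeasure \<mu> (- msupport \<mu>) = 0"
    and nd: "\<And>d h. 0 < d \<Longrightarrow> 0 < h \<Longrightarrow> eventually (\<lambda>i. nearly_diagonal (\<mu>s i) \<mu> d h) sequentially"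
    and haus: "(\<lambda>i. hausdorff_dist (msupport (\<mu>s i)) (msupport \<mu>)) \<longlonglongrightarrow> 0"
    and splits: "splits_keep_mass p \<mu>s"
    and d: "0 < d"
  shows "eventually (\<lambda>i. W_inf (\<mu>s i) \<mu> \<le> ennreal (10 * d)) sequentially"
proof -
  let ?K = "msupport \<mu>"
  interpret M: prob_space \<mu> by (rule borel_probD(3)[OF \<mu>])
  have K_ne: "?K \<noteq> {}" by (rule msupport_nonempty[OF \<mu> K(2)])
  obtain n y q where q: "q \<in> borel \<rightarrow>\<^sub>M count_space UNIV" "\<And>x. q x < (n::nat)"
    "\<And>x z. z \<in> ?K \<Longrightarrow> dist x z \<le> d \<Longrightarrow> dist x (y (q x)) < 2 * d"
    "\<And>l. l < n \<Longrightarrow> \<exists>x\<in>?K. \<exists>r>0. ball x r \<subseteq> q -` {l}"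
    using nearest_point_net[OF K(1) K_ne d] by metis
  have q_sets: "q -` C \<in> sets borel" for C using measurable_sets[OF q(1), of C] by simp
  have n: "0 < n" using q(2)[of undefined] by simp
  define R where "R = {(k, l). k < n \<and> l < n \<and> dist (y k) (y l) \<le> 5 * d}"
  have R: "R \<subseteq> {..<n} \<times> {..<n}" "sym R"
    unfolding R_def by (auto simp: sym_def dist_commute)
  define Cl where "Cl a = {k\<in>{..<n}. (a, k) \<in> R\<^sup>*}" for a
  have Cl_R: "l \<in> Cl a" if "k \<in> Cl a" "(k, l) \<in> R" for a k l
    using that R(1) unfolding Cl_def by (auto intro: rtrancl_into_rtrancl)
  have close: "eventually (\<lambda>i. \<forall>x\<in>msupport (\<mu>s i). \<exists>z\<in>?K. dist x z < d) sequentially"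
  proof -
    have "eventually (\<lambda>i. hausdorff_dist (msupport (\<mu>s i)) ?K < ennreal d) sequentially"
      using haus d unfolding ennreal_tendsto_0_iff by blast
    then show ?thesis by eventually_elim (use hausdorff_dist_lessD(1) in blast)
  qed
  have mass: "eventually (\<lambda>i. measure (\<mu>s i) (q -` Cl a) = measure \<mu> (q -` Cl a)) sequentially" for a
  proof (rule cluster_mass_eventually_eq[OF \<mu>s \<mu> p K(1) K_ne K(2) nd splits close d q_sets])
    show "closed (\<Union>k\<in>Cl a. cball (y k) (2 * d))" "closed (\<Union>k\<in>{..<n} - Cl a. cball (y k) (2 * d))"
      by (auto intro!: closed_UN simp: Cl_def)
    show "x \<in> (\<Union>k\<in>Cl a. cball (y k) (2 * d))" if "z \<in> ?K" "dist x z < d" "x \<in> q -` Cl a" for x z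
      using q(3)[of z x] that by (auto simp: dist_commute intro!: bexI[of _ "q x"])
    show "x \<in> (\<Union>k\<in>{..<n} - Cl a. cball (y k) (2 * d))" if "z \<in> ?K" "dist x z < d" "x \<notin> q -` Cl a" for x z
      using q(3)[of z x] q(2)[of x] that by (auto simp: dist_commute intro!: bexI[of _ "q x"])
    show "d \<le> dist u v" if u: "u \<in> (\<Union>k\<in>Cl a. cball (y k) (2 * d))"
      and v: "v \<in> (\<Union>k\<in>{..<n} - Cl a. cball (y k) (2 * d))" for u v
    proof -
      obtain k l where kl: "k \<in> Cl a" "dist (y k) u \<le> 2 * d" "l < n" "l \<notin> Cl a" "dist (y l) v \<le> 2 * d"
        using u v by auto
      then have "(k, l) \<notin> R" using Cl_R by blast
      then have "5 * d < dist (y k) (y l)" using kl unfolding R_def Cl_def by auto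
      then show ?thesis
        using kl(2,5) dist_triangle[of "y k" "y l" u] dist_triangle[of u "y l" v] by (simp add: dist_commute)
    qed
  qed (use d in auto)
  obtain C where C: "0 \<le> C"
    "\<And>w. (\<And>a. a \<in> {..<n} \<Longrightarrow> (\<Sum>k\<in>{k\<in>{..<n}. (a, k) \<in> R\<^sup>*}. w k) = 0) \<Longrightarrow>
      \<exists>f::nat \<Rightarrow> nat \<Rightarrow> real. (\<forall>k l. 0 \<le> f k l) \<and> (\<forall>k l. f k l > 0 \<longrightarrow> (k, l) \<in> R \<and> k \<noteq> l) \<and>
        (\<forall>k\<in>{..<n}. (\<Sum>l\<in>{..<n}. f k l) - (\<Sum>l\<in>{..<n}. f l k) = w k) \<and>
        (\<forall>k\<in>{..<n}. (\<Sum>l\<in>{..<n}. f k l) \<le> C * (\<Sum>a\<in>{..<n}. \<bar>w a\<bar>))"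
    using bounded_flow_exists[OF finite_lessThan R] by blast
  define nm where "nm l = measure \<mu> (q -` {l})" for l
  have nm_pos: "0 < nm l" if "l < n" for l
  proof -
    obtain x r where x: "x \<in> ?K" "0 < r" "ball x r \<subseteq> q -` {l}" using q(4)[OF \<open>l < n\<close>] by blast
    have "0 < emeasure \<mu> (ball x r)" using x by (intro emeasure_pos_of_msupport) auto
    also have "\<dots> \<le> emeasure \<mu> (q -` {l})" using x q_sets by (intro emeasure_mono) (auto simp: borel_probD[OF \<mu>])
    finally show ?thesis by (simp add: nm_def M.emeasure_eq_measure)
  qed
  define b where "b = Min (nm ` {..<n})"
  have b_pos: "0 < b" unfolding b_def using n nm_pos by (subst Min_gr_iff) auto
  have b_le: "b \<le> nm l" if "l < n" for l unfolding b_def using that by (intro Min_le) auto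
  \<comment> \<open>Each mass is off by at most \<open>h\<close>, so the outflow of a class is at most \<open>C * (n * h)\<close>, which must stay
      below the mass \<open>b - h\<close> that the class has at least.\<close>
  define h where "h = b / (2 + C * n)"
  have Cn: "0 \<le> C * n" using C(1) by simp
  have h: "0 < h" "2 * h + C * (n * h) = b"
  proof -
    have "0 < 2 + C * n" using Cn by linarith
    then show "0 < h" "2 * h + C * (n * h) = b"
      unfolding h_def using b_pos by (auto simp: divide_simps) (auto simp: algebra_simps)
  qed
  have "eventually (\<lambda>i. \<forall>a\<in>{..<n}. measure (\<mu>s i) (q -` Cl a) = measure \<mu> (q -` Cl a)) sequentially"
    using mass by (intro eventually_ball_finite) auto
  moreover note nd[OF d h(1)] close
  ultimately show ?thesis
  proof eventually_elim
    case (elim i)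
    then obtain L where L: "L \<in> couplings (\<mu>s i) \<mu>"
      and small: "measure L {z. dist (fst z) (snd z) > d} < h"
      unfolding nearly_diagonal_def by blast
    interpret L: prob_space L by (rule couplingsD(3)[OF L])
    let ?E = "{z. dist (fst z) (snd z) > d}"
    have E: "?E \<in> sets L" by (rule coupling_exceed_sets[OF L])
    have comp: "compact (msupport (\<mu>s i))" "emeasure (\<mu>s i) (- msupport (\<mu>s i)) = 0"
      using \<mu>s(2)[of i] unfolding compactly_supported_def by auto
    note ae1 = coupling_AE_fst[OF L borel_msupport comp(2)]
    note ae2 = coupling_AE_snd[OF L borel_msupport K(2)]
    define \<tau> where "\<tau> = (\<lambda>z::'a \<times> 'a. q (snd z))"
    define \<kappa> where "\<kappa> = (\<lambda>z::'a \<times> 'a. if z \<in> ?E then q (fst z) else q (snd z))"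
    have q_fst: "(\<lambda>z. q (fst z)) \<in> L \<rightarrow>\<^sub>M count_space UNIV" and \<tau>_L: "\<tau> \<in> L \<rightarrow>\<^sub>M count_space UNIV"
      unfolding \<tau>_def using coupling_fst_snd_measurable[OF L] q(1) by (auto intro: measurable_compose)
    have \<kappa>_L: "\<kappa> \<in> L \<rightarrow>\<^sub>M count_space UNIV"
      unfolding \<kappa>_def using E q_fst \<tau>_L couplingsD(2)[OF L] unfolding \<tau>_def
      by (intro measurable_If_set) auto
    have fibre: "{z. f z \<in> X} \<in> sets L" if "f \<in> L \<rightarrow>\<^sub>M count_space UNIV" for f :: "'a \<times> 'a \<Rightarrow> nat" and X
      using measurable_sets[OF that, of X] couplingsD(2)[OF L] by (simp add: vimage_def)
    have idx: "\<kappa> z < n" "\<tau> z < n" for z unfolding \<kappa>_def \<tau>_def using q(2) by auto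
    define m where "m k = measure L {z. \<kappa> z = k}" for k
    have nm: "nm l = measure L {z. \<tau> z = l}" for l
      unfolding nm_def \<tau>_def using coupling_prob_snd[OF L q_sets[of "{l}"]] by simp
    define w where "w k = m k - nm k" for k
    have w_small: "\<bar>w k\<bar> \<le> h" for k
    proof -
      have "m k \<le> measure L ({z. \<tau> z \<in> {k}} \<union> ?E)"
        unfolding m_def using E fibre[OF \<tau>_L, of "{k}"]
        by (intro L.finite_measure_mono) (auto simp: \<kappa>_def \<tau>_def split: if_splits)
      also have "\<dots> \<le> measure L {z. \<tau> z \<in> {k}} + measure L ?E"
        using E fibre[OF \<tau>_L, of "{k}"] by (intro measure_Un_le)
      finally have 1: "m k \<le> nm k + h" using small by (simp add: nm)
      have "nm k \<le> measure L ({z. \<kappa> z \<in> {k}} \<union> ?E)"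
        unfolding nm using E fibre[OF \<kappa>_L, of "{k}"]
        by (intro L.finite_measure_mono) (auto simp: \<kappa>_def \<tau>_def split: if_splits)
      also have "\<dots> \<le> measure L {z. \<kappa> z \<in> {k}} + measure L ?E"
        using E fibre[OF \<kappa>_L, of "{k}"] by (intro measure_Un_le)
      finally have 2: "nm k \<le> m k + h" using small by (simp add: m_def)
      show ?thesis using 1 2 unfolding w_def by linarith
    qed
    have w_sum: "(\<Sum>k\<in>Cl a. w k) = 0" if a: "a < n" for a
    proof -
      have fin: "finite (Cl a)" unfolding Cl_def by simp
      have "(\<Sum>k\<in>Cl a. w k) = measure L {z. \<kappa> z \<in> Cl a} - measure L {z. \<tau> z \<in> Cl a}"
        unfolding w_def sum_subtractf m_def nm
        using L.sum_measure_fibres[OF \<kappa>_L fin couplingsD(2)[OF L]]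
          L.sum_measure_fibres[OF \<tau>_L fin couplingsD(2)[OF L]] by simp
      also have "measure L {z. \<kappa> z \<in> Cl a} = measure L {z. q (fst z) \<in> Cl a}"
      proof (rule L.finite_measure_eq_AE)
        show "AE z in L. z \<in> {z. \<kappa> z \<in> Cl a} \<longleftrightarrow> z \<in> {z. q (fst z) \<in> Cl a}"
          using ae2
        proof eventually_elim
          case (elim z)
          show ?case
          proof (cases "z \<in> ?E")
            case False
            then have "dist (fst z) (y (q (fst z))) < 2 * d" "dist (snd z) (y (q (snd z))) < 2 * d"
              using q(3)[OF elim, of "fst z"] q(3)[OF elim, of "snd z"] d by auto
            then have "dist (y (q (fst z))) (y (q (snd z))) \<le> 5 * d"
              using False dist_triangle[of "y (q (fst z))" "y (q (snd z))" "fst z"]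
                dist_triangle[of "fst z" "y (q (snd z))" "snd z"] by (auto simp: dist_commute)
            then have "(q (fst z), q (snd z)) \<in> R" "(q (snd z), q (fst z)) \<in> R"
              unfolding R_def using q(2) by (auto simp: dist_commute)
            then show ?thesis using Cl_R False unfolding \<kappa>_def by auto
          qed (simp add: \<kappa>_def)
        qed
      qed (intro fibre[OF \<kappa>_L] fibre[OF q_fst])+
      also have "\<dots> = measure L {z. fst z \<in> q -` Cl a}" by simp
      also have "\<dots> = measure L {z. snd z \<in> q -` Cl a}"
        using elim(1) a by (simp only: coupling_prob_fst[OF L q_sets] coupling_prob_snd[OF L q_sets] lessThan_iff)
      finally show ?thesis by (simp add: \<tau>_def)
    qed
    obtain f :: "nat \<Rightarrow> nat \<Rightarrow> real" where f: "\<And>k l. 0 \<le> f k l" "\<And>k l. f k l > 0 \<Longrightarrow> (k, l) \<in> R \<and> k \<noteq> l"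
      "\<And>k. k < n \<Longrightarrow> (\<Sum>l<n. f k l) - (\<Sum>l<n. f l k) = w k"
      "\<And>k. k < n \<Longrightarrow> (\<Sum>l<n. f k l) \<le> C * (\<Sum>a<n. \<bar>w a\<bar>)"
      using C(2)[of w] w_sum unfolding Cl_def by (auto simp: Ball_def)
    have out: "(\<Sum>l<n. f k l) < m k" if k: "k < n" for k
    proof -
      have "(\<Sum>a<n. \<bar>w a\<bar>) \<le> n * h" using sum_mono[of "{..<n}" "\<lambda>a. \<bar>w a\<bar>" "\<lambda>_. h"] w_small by simp
      then have "(\<Sum>l<n. f k l) \<le> C * (n * h)" using f(4)[OF k] C(1) by (meson mult_left_mono order.trans)
      moreover have "nm k - h \<le> m k" using w_small[of k] unfolding w_def by linarith
      ultimately show ?thesis using h b_le[OF k] by linarith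
    qed
    have m_pos: "0 < m k" if "k < n" for k
      using out[OF that] sum_nonneg[of "{..<n}" "f k"] f(1) by force
    \<comment> \<open>Whatever does not flow out of a class stays in its cell; by the balance of \<open>f\<close> the column sums are \<open>nm\<close>.\<close>
    define c where "c k l = f k l + (if k = l then m k - (\<Sum>j<n. f k j) else 0)" for k l
    obtain D where D: "countable D" "msupport (\<mu>s i) \<union> ?K \<subseteq> closure D"
      using compact_countable_dense[OF compact_Un[OF comp(1) K(1)]] by blast
    have null: "emeasure (\<mu>s i) (- (msupport (\<mu>s i) \<union> ?K)) = 0" "emeasure \<mu> (- (msupport (\<mu>s i) \<union> ?K)) = 0"
    proof -
      have "emeasure (\<mu>s i) (- (msupport (\<mu>s i) \<union> ?K)) \<le> emeasure (\<mu>s i) (- msupport (\<mu>s i))"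
        using borel_comp[OF borel_msupport] by (intro emeasure_mono) (auto simp: borel_probD[OF \<mu>s(1)])
      then show "emeasure (\<mu>s i) (- (msupport (\<mu>s i) \<union> ?K)) = 0" using comp by simp
      have "emeasure \<mu> (- (msupport (\<mu>s i) \<union> ?K)) \<le> emeasure \<mu> (- ?K)"
        using borel_comp[OF borel_msupport] by (intro emeasure_mono) (auto simp: borel_probD[OF \<mu>])
      then show "emeasure \<mu> (- (msupport (\<mu>s i) \<union> ?K)) = 0" using K by simp
    qed
    obtain L' where L': "L' \<in> couplings (\<mu>s i) \<mu>" "AE z in L'. dist (fst z) (snd z) \<le> 10 * d"
    proof (rule recoupling[OF L closed_Un[OF closed_msupport closed_msupport] null D, where \<kappa>=\<kappa> and \<tau>=\<tau> and n=n
        and c=c and P="\<lambda>k u. dist u (y k) \<le> 3 * d" and Q="\<lambda>l v. dist v (y l) \<le> 2 * d" and r="10 * d"])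
      show "\<kappa> \<in> borel \<rightarrow>\<^sub>M count_space UNIV" "\<tau> \<in> borel \<rightarrow>\<^sub>M count_space UNIV"
        using \<kappa>_L \<tau>_L unfolding coupling_measurable[OF L] by auto
      show "\<kappa> z < n" "\<tau> z < n" for z by (rule idx)+
      show "0 \<le> c k l" if "k < n" "l < n" for k l
        unfolding c_def using f(1)[of k l] out[OF \<open>k < n\<close>] by auto
      show "(\<Sum>l<n. c k l) = measure L {z. \<kappa> z = k}" if "k < n" for k
        unfolding c_def m_def[symmetric] using that by (simp add: sum.distrib sum.delta)
      show "(\<Sum>k<n. c k l) = measure L {z. \<tau> z = l}" if "l < n" for l
      proof -
        have "(\<Sum>k<n. c k l) = (\<Sum>k<n. f k l) + (m l - (\<Sum>j<n. f l j))"
          unfolding c_def using that by (simp add: sum.distrib sum.delta')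
        also have "\<dots> = nm l" using f(3)[OF that] unfolding w_def by linarith
        finally show ?thesis by (simp add: nm)
      qed
      show "0 < measure L {z. \<kappa> z = k}" if "k < n" for k using m_pos[OF that] by (simp add: m_def)
      show "0 < measure L {z. \<tau> z = l}" if "l < n" for l using nm_pos[OF that] by (simp add: nm)
      show "AE z in L. dist (fst z) (y (\<kappa> z)) \<le> 3 * d"
        using ae1 ae2
      proof eventually_elim
        case (elim z)
        show ?case
        proof (cases "z \<in> ?E")
          case True
          obtain v where v: "v \<in> ?K" "dist (fst z) v < d"
            using \<open>\<forall>x\<in>msupport (\<mu>s i). \<exists>z\<in>?K. dist x z < d\<close> elim(1) by blast
          then show ?thesis using q(3)[OF v(1), of "fst z"] True d by (auto simp: \<kappa>_def)
        next
          case False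
          then show ?thesis
            using q(3)[OF elim(2), of "snd z"] d dist_triangle[of "fst z" "y (q (snd z))" "snd z"]
            by (auto simp: \<kappa>_def)
        qed
      qed
      show "AE z in L. dist (snd z) (y (\<tau> z)) \<le> 2 * d"
        using ae2
      proof eventually_elim
        case (elim z)
        then show ?case using q(3)[OF elim, of "snd z"] d by (auto simp: \<tau>_def)
      qed
      show "dist u v \<le> 10 * d" if kl: "k < n" "l < n" and ckl: "c k l > 0"
        and u: "dist u (y k) \<le> 3 * d" and v: "dist v (y l) \<le> 2 * d" for k l u v
      proof -
        have "dist (y k) (y l) \<le> 5 * d"
        proof (cases "k = l")
          case True
          then show ?thesis using d by simp
        next
          case False
          then have "f k l > 0" using ckl by (simp add: c_def)
          then show ?thesis using f(2)[of k l] unfolding R_def by auto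
        qed
        then show ?thesis
          using u v dist_triangle[of u v "y k"] dist_triangle[of "y k" v "y l"] by (simp add: dist_commute)
      qed
    qed
    then show ?case by (rule W_inf_le_of_coupling)
  qed
qed

text \<open>
  For the forward direction, a coupling that moves every point by less than \<open>e\<close>
  bounds both the transport cost and the Hausdorff distance, and with the latter the support of \<open>\<mu>\<close> is
  compact, being a closed Hausdorff limit of compact sets in a complete space.
\<close>

theorem theorem1p3:
  fixes \<mu>s :: "nat \<Rightarrow> 'a::complete_space measure"
    and \<mu> :: "'a measure"
    and p :: real
  assumes "\<And>i. borel_prob (\<mu>s i)"
    and "\<And>i. compactly_supported (\<mu>s i)"
    and "borel_prob \<mu>"
    and "1 \<le> p"
  shows "(\<lambda>i. W_inf (\<mu>s i) \<mu>) \<longlonglongrightarrow> 0 \<longleftrightarrow>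
    (\<lambda>i. W p (\<mu>s i) \<mu>) \<longlonglongrightarrow> 0 \<and>
    (\<lambda>i. hausdorff_dist (msupport (\<mu>s i)) (msupport \<mu>)) \<longlonglongrightarrow> 0 \<and>
    (\<forall>(\<mu>s1 :: nat \<Rightarrow> 'a measure) (\<mu>s2 :: nat \<Rightarrow> 'a measure) (\<mu>1 :: 'a measure) (\<mu>2 :: 'a measure).
      (\<forall>i. finite_borel_measure (\<mu>s1 i) \<and> finite_borel_measure (\<mu>s2 i)) \<and>
      finite_borel_measure \<mu>1 \<and> finite_borel_measure \<mu>2 \<and>
      (\<forall>i. \<forall>A\<in>sets borel. emeasure (\<mu>s i) A = emeasure (\<mu>s1 i) A + emeasure (\<mu>s2 i) A) \<and>
      W_conv p \<mu>s1 \<mu>1 \<and> W_conv p \<mu>s2 \<mu>2 \<and>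
      (INF i. set_dist (msupport (\<mu>s1 i)) (msupport (\<mu>s2 i))) > 0 \<longrightarrow>
      (\<exists>i0. \<forall>i\<ge>i0. emeasure (\<mu>s1 i) UNIV = emeasure \<mu>1 UNIV))"
  unfolding splits_keep_mass_def[symmetric]
proof -
  let ?H = "\<lambda>i. hausdorff_dist (msupport (\<mu>s i)) (msupport \<mu>)"
  have comp: "compact (msupport (\<mu>s i))" "emeasure (\<mu>s i) (- msupport (\<mu>s i)) = 0" for i
    using assms(2)[of i] unfolding compactly_supported_def by auto
  have K_full: "emeasure \<mu> (- msupport \<mu>) = 0" if "(\<lambda>i. W p (\<mu>s i) \<mu>) \<longlonglongrightarrow> 0"
  proof (rule full_msupport_of_nearly_diagonal[OF assms(1-3)])
    fix d h :: real assume "0 < d" "0 < h"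
    then show "\<exists>i. nearly_diagonal (\<mu>s i) \<mu> d h"
      using eventually_nearly_diagonal[OF assms(4) that] eventually_happens' sequentially_bot by blast
  qed
  have K_compact: "compact (msupport \<mu>)" if "?H \<longlonglongrightarrow> 0"
  proof (rule compact_hausdorff_limit[OF closed_msupport comp(1)])
    fix e :: real assume "0 < e"
    then have "eventually (\<lambda>i. ?H i < ennreal e) sequentially"
      using that unfolding ennreal_tendsto_0_iff by blast
    then show "\<exists>i. ?H i < ennreal e" using eventually_happens' sequentially_bot by blast
  qed
  have forward: "(\<lambda>i. W p (\<mu>s i) \<mu>) \<longlonglongrightarrow> 0 \<and> ?H \<longlonglongrightarrow> 0 \<and> splits_keep_mass p \<mu>s"
    if W0: "(\<lambda>i. W_inf (\<mu>s i) \<mu>) \<longlonglongrightarrow> 0"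
  proof -
    have coup: "eventually (\<lambda>i. \<exists>L\<in>couplings (\<mu>s i) \<mu>. AE z in L. dist (fst z) (snd z) < e) sequentially"
      if "0 < e" for e :: real
    proof -
      have "eventually (\<lambda>i. W_inf (\<mu>s i) \<mu> < ennreal e) sequentially"
        using W0 \<open>0 < e\<close> unfolding ennreal_tendsto_0_iff by blast
      then show ?thesis by eventually_elim (use W_inf_less_imp_coupling in blast)
    qed
    have Wp: "(\<lambda>i. W p (\<mu>s i) \<mu>) \<longlonglongrightarrow> 0"
      unfolding ennreal_tendsto_0_iff
    proof (intro allI impI)
      fix e :: real assume e: "0 < e"
      have "0 < e / 2" using e by simp
      from coup[OF this] show "eventually (\<lambda>i. W p (\<mu>s i) \<mu> < ennreal e) sequentially"
      proof eventually_elim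
        case (elim i)
        then obtain L where L: "L \<in> couplings (\<mu>s i) \<mu>" "AE z in L. dist (fst z) (snd z) < e / 2" by blast
        from L(2) have "AE z in L. dist (fst z) (snd z) \<le> e / 2" by eventually_elim simp
        then have "W p (\<mu>s i) \<mu> \<le> ennreal (e / 2)" using W_le_of_coupling[OF assms(4) L(1)] e by simp
        also have "\<dots> < ennreal e" using e by (simp add: ennreal_less_iff)
        finally show ?case .
      qed
    qed
    note full = K_full[OF Wp]
    have H: "?H \<longlonglongrightarrow> 0"
      unfolding ennreal_tendsto_0_iff
    proof (intro allI impI)
      fix e :: real assume e: "0 < e"
      have "0 < e / 3" using e by simp
      from coup[OF this] show "eventually (\<lambda>i. ?H i < ennreal e) sequentially"
      proof eventually_elim
        case (elim i)
        then obtain L where L: "L \<in> couplings (\<mu>s i) \<mu>" "AE z in L. dist (fst z) (snd z) < e / 3" by blast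
        have "?H i \<le> ennreal (2 * (e / 3))"
          using e by (intro hausdorff_dist_le_of_coupling[OF assms(1) comp(2) assms(3) full L]) auto
        also have "\<dots> < ennreal e" using e by (simp add: ennreal_less_iff)
        finally show ?case .
      qed
    qed
    have "splits_keep_mass p \<mu>s"
      unfolding splits_keep_mass_def
    proof (intro allI impI, elim conjE)
      fix \<mu>s1 \<mu>s2 :: "nat \<Rightarrow> 'a measure" and \<mu>1 \<mu>2 :: "'a measure"
      assume fin: "\<forall>i. finite_borel_measure (\<mu>s1 i) \<and> finite_borel_measure (\<mu>s2 i)"
        and fin1: "finite_borel_measure \<mu>1"
        and sum: "\<forall>i. \<forall>A\<in>sets borel. emeasure (\<mu>s i) A = emeasure (\<mu>s1 i) A + emeasure (\<mu>s2 i) A"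
        and conv: "W_conv p \<mu>s1 \<mu>1"
        and sep: "(INF i. set_dist (msupport (\<mu>s1 i)) (msupport (\<mu>s2 i))) > 0"
      obtain t where t: "0 < t" "t < (INF i. set_dist (msupport (\<mu>s1 i)) (msupport (\<mu>s2 i)))"
        using dense[OF sep] by blast
      then have "t < top" by (meson less_le_trans top_greatest)
      then obtain e where e: "t = ennreal e" "0 < e" using t(1) by (cases t) auto
      have sep_i: "ennreal e \<le> set_dist (msupport (\<mu>s1 i)) (msupport (\<mu>s2 i))" for i
        using t(2) e(1) by (meson INF_lower UNIV_I less_imp_le order.trans)
      obtain V :: "real set" where V: "finite V"
        "\<And>\<nu> \<alpha> \<beta> L. \<lbrakk>sets \<nu> = sets borel; compactly_supported \<nu>;
          L \<in> couplings \<nu> \<mu>; AE z in L. dist (fst z) (snd z) < e / 8;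
          finite_borel_measure \<alpha>; finite_borel_measure \<beta>;
          \<And>A. A \<in> sets borel \<Longrightarrow> emeasure \<nu> A = emeasure \<alpha> A + emeasure \<beta> A;
          ennreal e \<le> set_dist (msupport \<alpha>) (msupport \<beta>)\<rbrakk> \<Longrightarrow> measure \<alpha> UNIV \<in> V"
        using separated_part_mass_finitely_many_values[OF K_compact[OF H] msupport_nonempty[OF assms(3) full] full e(2)]
        by blast
      have "0 < e / 8" using e(2) by simp
      from coup[OF this] have "eventually (\<lambda>i. measure (\<mu>s1 i) UNIV \<in> V) sequentially"
      proof eventually_elim
        case (elim i)
        then obtain L where L: "L \<in> couplings (\<mu>s i) \<mu>" "AE z in L. dist (fst z) (snd z) < e / 8" by blast
        show ?case
          by (rule V(2)[OF borel_probD(1)[OF assms(1)] assms(2) L, where \<beta>="\<mu>s2 i"]) (use fin sum sep_i in auto)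
      qed
      moreover have "(\<lambda>i. measure (\<mu>s1 i) UNIV) \<longlonglongrightarrow> measure \<mu>1 UNIV"
      proof -
        have "(\<lambda>i. \<integral>x. (1::real) \<partial>\<mu>s1 i) \<longlonglongrightarrow> (\<integral>x. 1 \<partial>\<mu>1)"
          using conv[unfolded W_conv_def] by (auto intro!: bspec simp del: lebesgue_integral_const dest!: spec[of _ "\<lambda>_. 1"])
        moreover have "space (\<mu>s1 i) = UNIV" for i
          using finite_borel_measureD(2) fin by blast
        ultimately show ?thesis using finite_borel_measureD(2)[OF fin1] by simp
      qed
      ultimately have "eventually (\<lambda>i. measure (\<mu>s1 i) UNIV = measure \<mu>1 UNIV) sequentially"
        using tendsto_finite_range_eventually_eq V(1) by blast
      then have "eventually (\<lambda>i. emeasure (\<mu>s1 i) UNIV = emeasure \<mu>1 UNIV) sequentially"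
      proof eventually_elim
        case (elim i)
        have "finite_measure (\<mu>s1 i)" "finite_measure \<mu>1"
          using fin fin1 finite_borel_measureD(3) by blast+
        with elim show ?case by (simp add: finite_measure.emeasure_eq_measure)
      qed
      then show "\<exists>i0. \<forall>i\<ge>i0. emeasure (\<mu>s1 i) UNIV = emeasure \<mu>1 UNIV"
        unfolding eventually_sequentially .
    qed
    with Wp H show ?thesis by blast
  qed
  have backward: "(\<lambda>i. W_inf (\<mu>s i) \<mu>) \<longlonglongrightarrow> 0"
    if Wp: "(\<lambda>i. W p (\<mu>s i) \<mu>) \<longlonglongrightarrow> 0" and H: "?H \<longlonglongrightarrow> 0" and splits: "splits_keep_mass p \<mu>s"
    unfolding ennreal_tendsto_0_iff
  proof (intro allI impI)
    fix e :: real assume e: "0 < e"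
    have "eventually (\<lambda>i. W_inf (\<mu>s i) \<mu> \<le> ennreal (10 * (e / 20))) sequentially"
      using e by (intro W_inf_eventually_le[OF assms K_compact[OF H] K_full[OF Wp] _ H splits]
          eventually_nearly_diagonal[OF assms(4) Wp]) auto
    then show "eventually (\<lambda>i. W_inf (\<mu>s i) \<mu> < ennreal e) sequentially"
    proof eventually_elim
      case (elim i)
      also have "ennreal (10 * (e / 20)) < ennreal e" using e by (simp add: ennreal_less_iff)
      finally show ?case .
    qed
  qed
  show "(\<lambda>i. W_inf (\<mu>s i) \<mu>) \<longlonglongrightarrow> 0 \<longleftrightarrow>
    (\<lambda>i. W p (\<mu>s i) \<mu>) \<longlonglongrightarrow> 0 \<and> ?H \<longlonglongrightarrow> 0 \<and> splits_keep_mass p \<mu>s"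
    using forward backward by blast
qed

end
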